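(* Let $G$ be a simple connected unicyclic graph with $n$ vertices that is not the cycle $C_n$. Then $G$ has exactly two main signless Laplacian eigenvalues if and only if $G$ is isomorphic to $G_1$ or to $G_2$, where: $G_1$ is the graph obtained from a cycle of length $r\geq 3$ by attaching $k\geq 1$ pendant vertices to each vertex of the cycle (so $n=(k+1)r$); and $G_2$ is the graph obtained from a cycle $u_1u_2\cdots u_{3t}u_1$ ($t\geq 1$) by attaching one pendant vertex to each of the vertices $u_{3s+1}$, $s=0,1,\dots,t-1$ (so $n=4t$).
   Context: For a graph $G$ with adjacency matrix $A$ and diagonal degree matrix $D$, the signless Laplacian is $Q=D+A$; an eigenvalue of $Q$ is a main signless Laplacian eigenvalue if it has an eigenvector whose entries do not sum to zero. A unicyclic graph is a connected graph with exactly one cycle. Attaching a pendant vertex to $v$ means adding a new vertex adjacent only to $v$. *)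

theory Defs
  imports "HOL-Analysis.Analysis" "Graph_Theory.Graph_Theory"
begin

text \<open>
  Simple graphs are the finite, loop-free, symmetric digraphs without parallel arcs of
  \<^locale>\<open>pair_graph\<close>: an edge between \<open>u\<close> and \<open>v\<close> is the pair of arcs \<open>(u, v)\<close>, \<open>(v, u)\<close>.
\<close>

text \<open>This is the cycle \<open>C\<^sub>r\<close> only for \<open>r \<ge> 3\<close> (for \<open>r = 1\<close> it has a loop, for \<open>r = 2\<close> it is an edge).\<close>

definition cycle_graph :: "nat \<Rightarrow> nat pair_pre_digraph" where
  "cycle_graph r = \<lparr>
     pverts = {..<r},
     parcs = {(i, j). i < r \<and> j < r \<and> (j = (i + 1) mod r \<or> i = (j + 1) mod r)} \<rparr>"

text \<open>
  Cycles of \<open>G\<close> are subgraphs isomorphic to some \<open>C\<^sub>r\<close>, rather than closed walks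
  (\<open>pre_digraph.cycle\<close>), which would distinguish rotations and the two orientations and would
  count the walk back and forth along an edge.
\<close>

definition is_cycle_of :: "'a pair_pre_digraph \<Rightarrow> 'a pair_pre_digraph \<Rightarrow> bool" where
  "is_cycle_of H G \<longleftrightarrow>
     subgraph (with_proj H) (with_proj G) \<and>
     (\<exists>r\<ge>3. digraph_iso (with_proj H) (with_proj (cycle_graph r)))"

definition unicyclic :: "'a pair_pre_digraph \<Rightarrow> bool" where
  "unicyclic G \<longleftrightarrow> Digraph_Component.connected (with_proj G) \<and> (\<exists>!H. is_cycle_of H G)"

text \<open>
  Attach \<open>p v\<close> pendant vertices to every vertex \<open>v\<close>. The old vertex \<open>v\<close> becomes \<open>(v, 0)\<close>, its
  pendant vertices are \<open>(v, 1), \<dots>, (v, p v)\<close>.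
\<close>

definition attach_pendants ::
    "'a pair_pre_digraph \<Rightarrow> ('a \<Rightarrow> nat) \<Rightarrow> ('a \<times> nat) pair_pre_digraph" where
  "attach_pendants G p = \<lparr>
     pverts = {(v, i). v \<in> pverts G \<and> i \<le> p v},
     parcs = {((u, 0), (v, 0)) | u v. (u, v) \<in> parcs G}
           \<union> {((v, 0), (v, i)) | v i. v \<in> pverts G \<and> 1 \<le> i \<and> i \<le> p v}
           \<union> {((v, i), (v, 0)) | v i. v \<in> pverts G \<and> 1 \<le> i \<and> i \<le> p v} \<rparr>"

definition G1 :: "nat \<Rightarrow> nat \<Rightarrow> (nat \<times> nat) pair_pre_digraph" where
  "G1 r k = attach_pendants (cycle_graph r) (\<lambda>_. k)"

text \<open>The cycle vertex \<open>u\<^sub>j\<close> (\<open>1 \<le> j \<le> 3t\<close>) is the number \<open>j - 1\<close>, so \<open>u\<^bsub>3s+1\<^esub>\<close> is \<open>3s\<close>.\<close>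

definition G2 :: "nat \<Rightarrow> (nat \<times> nat) pair_pre_digraph" where
  "G2 t = attach_pendants (cycle_graph (3 * t)) (\<lambda>i. if \<exists>s<t. i = 3 * s then 1 else 0)"

text \<open>The matrices are indexed by the vertex type, so they are meant for \<open>pverts G = UNIV\<close>.\<close>

definition adjacency_matrix :: "'a::finite pair_pre_digraph \<Rightarrow> real ^ 'a ^ 'a" where
  "adjacency_matrix G = (\<chi> u v. if (u, v) \<in> parcs G then 1 else 0)"

definition degree_matrix :: "'a::finite pair_pre_digraph \<Rightarrow> real ^ 'a ^ 'a" where
  "degree_matrix G = (\<chi> u v. if u = v then real (out_degree (with_proj G) u) else 0)"

definition signless_laplacian :: "'a::finite pair_pre_digraph \<Rightarrow> real ^ 'a ^ 'a" where
  "signless_laplacian G = degree_matrix G + adjacency_matrix G"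

definition is_eigenvector :: "real ^ 'a ^ 'a \<Rightarrow> real ^ 'a \<Rightarrow> real \<Rightarrow> bool" where
  "is_eigenvector M x \<mu> \<longleftrightarrow> x \<noteq> 0 \<and> M *v x = \<mu> *\<^sub>R x"

text \<open>
  The matrix is real symmetric, so all its eigenvalues are real; real eigenvectors suffice because
  a complex eigenvector with nonzero entry sum has a real or imaginary part with nonzero entry sum.
\<close>

definition main_signless_laplacian_eigenvalue :: "'a::finite pair_pre_digraph \<Rightarrow> real \<Rightarrow> bool" where
  "main_signless_laplacian_eigenvalue G \<mu> \<longleftrightarrow>
     (\<exists>x. is_eigenvector (signless_laplacian G) x \<mu> \<and> (\<Sum>v\<in>UNIV. x $ v) \<noteq> 0)"

end

theory Submission
  imports Defs
begin

text \<open>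
  The matrix \<open>Q\<close> is symmetric, so the all-ones vector \<open>j\<close> is the sum of its projections to the
  eigenspaces, and the main eigenvalues are those with a nonzero projection. There are exactly two
  of them iff \<open>j\<close> and \<open>Q j\<close> are independent and \<open>Q\<^sup>2 j\<close> is a combination of them. As \<open>Q j = 2 d\<close> for the
  degree vector \<open>d\<close>, this says that \<open>G\<close> is not regular and that the sum of the degrees of the
  neighbours of \<open>v\<close> is \<open>a d(v) + b - d(v)\<^sup>2\<close> with constants \<open>a\<close>, \<open>b\<close>.

  In particular all neighbours of leaves have the same degree \<open>\<Delta>\<close>. If some vertex has distance at
  least 2 from the cycle, take one at maximal distance, its neighbour \<open>w\<close> and the next vertex \<open>y\<close>
  towards the cycle; with \<open>p = \<Delta> - 1\<close> and \<open>e = d(y) - 1\<close> the equations at \<open>w\<close> and \<open>y\<close> contradict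
  divisibility by \<open>p\<close>. So \<open>G\<close> is a cycle with pendant vertices, its cycle vertices have degree 2 or
  \<open>\<Delta>\<close>, and the equation determines how these degrees alternate along the cycle.
\<close>

section \<open>Main eigenvalues of symmetric matrices\<close>

text \<open>A maximiser of the quadratic form \<open>x \<bullet> f x\<close> on the unit sphere of
  \<open>U\<close> is an eigenvector. Working in an invariant subspace makes it possible to find
  eigenvectors orthogonal to given ones.\<close>

lemma selfadjoint_eigenvector_exists:
  fixes f :: "'a::euclidean_space \<Rightarrow> 'a"
  assumes lin: "linear f" and adj: "\<And>x y. f x \<bullet> y = x \<bullet> f y"
    and U: "subspace U" and inv: "\<And>x. x \<in> U \<Longrightarrow> f x \<in> U" and u: "u \<in> U" "u \<noteq> 0"
  obtains x l where "x \<in> U" "x \<noteq> 0" "f x = l *\<^sub>R x"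
proof -
  let ?S = "U \<inter> sphere 0 1"
  have contf: "continuous_on A f" for A
    using lin by (simp add: linear_continuous_on linear_conv_bounded_linear)
  have "compact ?S"
    by (simp add: U closed_subspace closed_Int_compact)
  moreover have "(1 / norm u) *\<^sub>R u \<in> ?S"
    using u U by (auto simp: subspace_scale)
  then have "?S \<noteq> {}" by blast
  moreover have "continuous_on ?S (\<lambda>x. x \<bullet> f x)"
    by (intro continuous_intros contf)
  ultimately obtain x where x: "x \<in> ?S" and max: "\<And>y. y \<in> ?S \<Longrightarrow> y \<bullet> f y \<le> x \<bullet> f x"
    by (metis continuous_attains_sup)
  define l where "l = x \<bullet> f x"
  \<comment> \<open>The form \<open>l \<parallel>y\<parallel>\<^sup>2 - y \<bullet> f y\<close> is nonnegative on \<open>U\<close> and vanishes at its minimum \<open>x\<close>, so its derivative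
      there, taken in the direction \<open>l x - f x\<close>, is zero.\<close>
  have xx: "x \<bullet> x = 1" "x \<in> U" using x by (auto simp: norm_eq_1)
  have le: "y \<bullet> f y \<le> l * (y \<bullet> y)" if "y \<in> U" for y
  proof (cases "y = 0")
    case False
    have "(1 / norm y) *\<^sub>R y \<in> ?S" using that False U by (auto simp: subspace_scale)
    from max[OF this] have "(y \<bullet> f y) / (norm y)\<^sup>2 \<le> l"
      by (simp add: l_def linear_scale[OF lin] power2_eq_square)
    then show ?thesis
      using False by (simp add: divide_le_eq power2_norm_eq_inner)
  qed (simp add: linear_0[OF lin])
  define y where "y = l *\<^sub>R x - f x"
  have yU: "y \<in> U" unfolding y_def using xx U inv by (simp add: subspace_diff subspace_scale)
  define B where "B = l * (y \<bullet> y) - y \<bullet> f y"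
  have quad: "0 \<le> 2 * t * (y \<bullet> y) + t\<^sup>2 * B" for t
  proof -
    have "x + t *\<^sub>R y \<in> U" using yU xx U by (simp add: subspace_add subspace_scale)
    from le[OF this] have "0 \<le> l * ((x + t *\<^sub>R y) \<bullet> (x + t *\<^sub>R y)) - (x + t *\<^sub>R y) \<bullet> f (x + t *\<^sub>R y)"
      by simp
    also have "\<dots> = 2 * t * (l * (x \<bullet> y) - f x \<bullet> y) + t\<^sup>2 * B"
      unfolding B_def using xx(1) adj[of x y]
      by (simp add: linear_add[OF lin] linear_scale[OF lin] inner_add_left inner_add_right
          inner_commute power2_eq_square algebra_simps l_def)
    also have "l * (x \<bullet> y) - f x \<bullet> y = y \<bullet> y"
      by (simp add: y_def inner_diff_left)
    finally show ?thesis .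
  qed
  have "y \<bullet> y \<le> 0"
  proof (rule ccontr)
    assume "\<not> y \<bullet> y \<le> 0"
    then have pos: "y \<bullet> y > 0" by linarith
    \<comment> \<open>Negative, and so small that the quadratic term cannot outweigh the linear one:
      \<open>\<bar>t * B\<bar> \<le> y \<bullet> y\<close>.\<close>
    define t where "t = - (y \<bullet> y) / (\<bar>B\<bar> + 1)"
    have t: "t < 0" unfolding t_def using pos by (simp add: divide_neg_pos)
    have "t * (2 * (y \<bullet> y) + t * B) \<ge> 0" using quad[of t] by (simp add: algebra_simps power2_eq_square)
    then have "2 * (y \<bullet> y) + t * B \<le> 0" using t by (simp add: zero_le_mult_iff)
    moreover have "\<bar>t * B\<bar> \<le> y \<bullet> y"
    proof -
      have "\<bar>t * B\<bar> = (y \<bullet> y) * (\<bar>B\<bar> / (\<bar>B\<bar> + 1))" unfolding t_def using pos by (simp add: abs_mult)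
      also have "\<dots> \<le> (y \<bullet> y) * 1" using pos by (intro mult_left_mono) auto
      finally show ?thesis by simp
    qed
    ultimately show False using pos by linarith
  qed
  then have "y = 0" by (metis inner_ge_zero inner_eq_zero_iff order_antisym)
  then have "f x = l *\<^sub>R x" by (simp add: y_def)
  moreover have "x \<noteq> 0" using xx by auto
  ultimately show ?thesis using that xx by blast
qed

text \<open>The orthogonal complement of all eigenvectors is invariant because \<open>f\<close> is
  self-adjoint; if nonzero, it would contain an eigenvector. Grouping by eigenvalue leaves a single
  component \<open>x \<mu>\<close> for each \<open>\<mu>\<close> in \<open>S\<close>.\<close>

lemma selfadjoint_spectral_decomposition:
  fixes f :: "'a::euclidean_space \<Rightarrow> 'a"
  assumes lin: "linear f" and adj: "\<And>x y. f x \<bullet> y = x \<bullet> f y"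
  obtains S x where "finite S" "v = sum x S" "\<And>\<mu>. \<mu> \<in> S \<Longrightarrow> x \<mu> \<noteq> 0"
    "\<And>\<mu>. f (x \<mu>) = \<mu> *\<^sub>R x \<mu>"
proof -
  let ?E = "{x. \<exists>\<mu>. f x = \<mu> *\<^sub>R x}"
  have "span ?E = UNIV"
  proof (rule ccontr)
    assume "span ?E \<noteq> UNIV"
    then obtain u where u: "u \<noteq> 0" "\<And>w. w \<in> span ?E \<Longrightarrow> u \<bullet> w = 0"
      using span_not_UNIV_orthogonal by blast
    let ?U = "{y. \<forall>w\<in>?E. w \<bullet> y = 0}"
    have "subspace ?U" unfolding subspace_def by (auto simp: inner_add_right)
    moreover have "f y \<in> ?U" if "y \<in> ?U" for y
    proof -
      have "w \<bullet> f y = 0" if "f w = l *\<^sub>R w" for w l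
        using \<open>y \<in> ?U\<close> that adj[of w y] by auto
      then show ?thesis by blast
    qed
    moreover have "u \<in> ?U" using u(2) by (auto intro: span_base simp: inner_commute)
    ultimately obtain x l where "x \<in> ?U" "x \<noteq> 0" "f x = l *\<^sub>R x"
      using u(1) by (rule selfadjoint_eigenvector_exists[OF lin adj])
    then show False by fastforce
  qed
  then have "v \<in> span ?E" by simp
  then have "\<exists>S x. finite S \<and> v = sum x S \<and> (\<forall>\<mu>. f (x \<mu>) = \<mu> *\<^sub>R x \<mu>) \<and> (\<forall>\<mu>. \<mu> \<notin> S \<longrightarrow> x \<mu> = 0)"
  proof (induction rule: span_induct_alt)
    case base
    show ?case by (rule exI[of _ "{}"], rule exI[of _ "\<lambda>_. 0"]) (simp add: linear_0[OF lin])
  next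
    case (step c e w)
    then obtain S x \<nu> where S: "finite S" "w = sum x S" "\<forall>\<mu>. f (x \<mu>) = \<mu> *\<^sub>R x \<mu>"
      "\<forall>\<mu>. \<mu> \<notin> S \<longrightarrow> x \<mu> = 0" and e: "f e = \<nu> *\<^sub>R e" by auto
    \<comment> \<open>The new summand joins the component of its eigenvalue \<open>\<nu>\<close>; if
      \<open>\<nu>\<close> is not yet in \<open>S\<close>, that component was zero.\<close>
    let ?x = "\<lambda>\<mu>. x \<mu> + (if \<mu> = \<nu> then c *\<^sub>R e else 0)"
    have "sum x (insert \<nu> S) = sum x S"
      using S by (intro sum.mono_neutral_right) auto
    then have "c *\<^sub>R e + w = sum ?x (insert \<nu> S)"
      using S(1,2) by (simp add: sum.distrib)
    moreover have "\<forall>\<mu>. f (?x \<mu>) = \<mu> *\<^sub>R ?x \<mu>"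
      using S(3) e by (simp add: linear_add[OF lin] linear_scale[OF lin] linear_0[OF lin] algebra_simps)
    moreover have "\<forall>\<mu>. \<mu> \<notin> insert \<nu> S \<longrightarrow> ?x \<mu> = 0" using S(4) by simp
    moreover have "finite (insert \<nu> S)" using S(1) by simp
    ultimately show ?case by (intro exI[of _ "insert \<nu> S"] exI[of _ ?x] conjI)
  qed
  then obtain S x where S: "finite S" "v = sum x S" "\<forall>\<mu>. f (x \<mu>) = \<mu> *\<^sub>R x \<mu>"
      "\<forall>\<mu>. \<mu> \<notin> S \<longrightarrow> x \<mu> = 0" by blast
  show ?thesis
  proof
    show "finite {\<mu>\<in>S. x \<mu> \<noteq> 0}" using S by simp
    show "v = sum x {\<mu>\<in>S. x \<mu> \<noteq> 0}"
      unfolding S(2) using S(1) by (intro sum.mono_neutral_right) auto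
  qed (use S in auto)
qed

text \<open>Eigenvectors for distinct eigenvalues are orthogonal. So the main eigenvalues are the
  set \<open>S\<close> in the decomposition of \<open>j\<close>, and a linear relation between
  \<open>j\<close>, \<open>f j\<close> and \<open>f (f j)\<close> holds iff the corresponding
  polynomial vanishes on \<open>S\<close>.\<close>

lemma card_main_eigenvalues_eq_2_iff:
  fixes f :: "'a::euclidean_space \<Rightarrow> 'a"
  assumes lin: "linear f" and adj: "\<And>x y. f x \<bullet> y = x \<bullet> f y"
  shows "card {\<mu>. \<exists>x. f x = \<mu> *\<^sub>R x \<and> x \<bullet> j \<noteq> 0} = 2 \<longleftrightarrow>
    (\<nexists>c. f j = c *\<^sub>R j) \<and> (\<exists>a b. f (f j) = a *\<^sub>R f j + b *\<^sub>R j)" (is "card ?M = 2 \<longleftrightarrow> _")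
proof -
  obtain S x where S: "finite S" "j = sum x S" "\<And>\<mu>. \<mu> \<in> S \<Longrightarrow> x \<mu> \<noteq> 0"
    and ev: "\<And>\<mu>. f (x \<mu>) = \<mu> *\<^sub>R x \<mu>"
    using selfadjoint_spectral_decomposition[OF lin adj] by metis
  have orth: "y \<bullet> x \<mu> = 0" if "f y = \<nu> *\<^sub>R y" "\<mu> \<noteq> \<nu>" for y \<mu> \<nu>
  proof -
    have "\<nu> * (y \<bullet> x \<mu>) = \<mu> * (y \<bullet> x \<mu>)"
      using adj[of y "x \<mu>"] that ev by simp
    then show ?thesis using that by simp
  qed
  have inner_j: "y \<bullet> j = (if \<nu> \<in> S then y \<bullet> x \<nu> else 0)" if "f y = \<nu> *\<^sub>R y" for y \<nu>
  proof -
    have "y \<bullet> j = (\<Sum>\<mu>\<in>S. if \<mu> = \<nu> then y \<bullet> x \<nu> else 0)"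
      unfolding S(2) inner_sum_right by (intro sum.cong) (auto simp: orth[OF that])
    then show ?thesis using S(1) by simp
  qed
  have M: "?M = S"
  proof (intro set_eqI iffI)
    fix \<mu> assume "\<mu> \<in> S"
    then have "x \<mu> \<bullet> j \<noteq> 0" using inner_j[OF ev] S(3) by simp
    with ev show "\<mu> \<in> ?M" by auto
  next
    fix \<mu> assume "\<mu> \<in> ?M"
    then obtain y where "f y = \<mu> *\<^sub>R y" "y \<bullet> j \<noteq> 0" by blast
    then show "\<mu> \<in> S" using inner_j[of y \<mu>] by metis
  qed
  have fj: "f j = (\<Sum>\<mu>\<in>S. \<mu> *\<^sub>R x \<mu>)" unfolding S(2) by (simp add: linear_sum[OF lin] ev)
  have ffj: "f (f j) = (\<Sum>\<mu>\<in>S. \<mu>\<^sup>2 *\<^sub>R x \<mu>)"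
    unfolding fj by (simp add: linear_sum[OF lin] linear_scale[OF lin] ev power2_eq_square)
  have indep: "h \<mu> = 0" if "(\<Sum>\<mu>\<in>S. h \<mu> *\<^sub>R x \<mu>) = 0" "\<mu> \<in> S" for h :: "real \<Rightarrow> real" and \<mu>
  proof -
    have "0 = x \<mu> \<bullet> (\<Sum>\<nu>\<in>S. h \<nu> *\<^sub>R x \<nu>)" using that by simp
    also have "\<dots> = (\<Sum>\<nu>\<in>S. if \<nu> = \<mu> then h \<mu> * (x \<mu> \<bullet> x \<mu>) else 0)"
      unfolding inner_sum_right by (intro sum.cong) (auto simp: orth[OF ev])
    also have "\<dots> = h \<mu> * (x \<mu> \<bullet> x \<mu>)" using S(1) that by simp
    finally show ?thesis using S(3) that by simp
  qed
  show ?thesis unfolding M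
  proof
    assume "card S = 2"
    then obtain \<mu> \<nu> where mn: "S = {\<mu>, \<nu>}" "\<mu> \<noteq> \<nu>" by (auto simp: card_2_iff)
    have False if "f j = c *\<^sub>R j" for c
    proof -
      have "(\<Sum>\<mu>\<in>S. (\<mu> - c) *\<^sub>R x \<mu>) = 0"
        using that unfolding fj by (simp add: S(2) scaleR_diff_left sum_subtractf scaleR_sum_right)
      from indep[OF this, of \<mu>] indep[OF this, of \<nu>] show False using mn by simp
    qed
    \<comment> \<open>The coefficients come from the quadratic with roots \<open>\<mu>\<close> and
      \<open>\<nu>\<close>.\<close>
    moreover have "f (f j) = (\<mu> + \<nu>) *\<^sub>R f j + (- \<mu> * \<nu>) *\<^sub>R j"
      unfolding ffj unfolding fj using mn by (simp add: S(2) algebra_simps power2_eq_square)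
    ultimately show "(\<nexists>c. f j = c *\<^sub>R j) \<and> (\<exists>a b. f (f j) = a *\<^sub>R f j + b *\<^sub>R j)" by blast
  next
    assume "(\<nexists>c. f j = c *\<^sub>R j) \<and> (\<exists>a b. f (f j) = a *\<^sub>R f j + b *\<^sub>R j)"
    then obtain a b where nc: "\<nexists>c. f j = c *\<^sub>R j" and ab: "f (f j) = a *\<^sub>R f j + b *\<^sub>R j" by blast
    have "(\<Sum>\<mu>\<in>S. (\<mu>\<^sup>2 - a * \<mu> - b) *\<^sub>R x \<mu>) = 0"
      using ab unfolding ffj unfolding fj
      by (simp add: S(2) scaleR_diff_left sum_subtractf scaleR_sum_right)
    note roots = indep[OF this]
    have "S \<noteq> {}" using nc fj S(2) by auto
    then obtain \<mu> where mu: "\<mu> \<in> S" by blast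
    have "S \<noteq> {\<mu>}" using nc fj S(2) by auto
    then obtain \<nu> where nu: "\<nu> \<in> S" "\<nu> \<noteq> \<mu>" using mu by blast
    have "\<kappa> = \<mu> \<or> \<kappa> = \<nu>" if "\<kappa> \<in> S" for \<kappa>
    proof (rule ccontr)
      assume *: "\<not> ?thesis"
      \<comment> \<open>A quadratic has no third root: differences of its values factor, which would
        give \<open>\<kappa> + \<mu> = a = \<kappa> + \<nu>\<close>.\<close>
      have "(\<kappa> - \<mu>) * (\<kappa> + \<mu> - a) = 0" "(\<kappa> - \<nu>) * (\<kappa> + \<nu> - a) = 0"
        using roots[OF that] roots[OF mu] roots[OF nu(1)] by (auto simp: algebra_simps power2_eq_square)
      then show False using * nu by simp
    qed
    then have "S = {\<mu>, \<nu>}" using mu nu by auto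
    then show "card S = 2" using nu by simp
  qed
qed

section \<open>Degrees and the main signless Laplacian eigenvalues\<close>

definition neighbours :: "'a pair_pre_digraph \<Rightarrow> 'a \<Rightarrow> 'a set" where
  "neighbours G v = {w. (v, w) \<in> parcs G}"

definition deg :: "'a pair_pre_digraph \<Rightarrow> 'a \<Rightarrow> nat" where
  "deg G v = card (neighbours G v)"

definition nbr_deg_sum :: "'a pair_pre_digraph \<Rightarrow> 'a \<Rightarrow> nat" where
  "nbr_deg_sum G v = (\<Sum>w\<in>neighbours G v. deg G w)"

lemma out_degree_with_proj: "out_degree (with_proj G) v = deg G v"
proof -
  have "out_arcs (with_proj G) v = Pair v ` neighbours G v"
    by (auto simp: out_arcs_def neighbours_def)
  then show ?thesis by (simp add: out_degree_def deg_def card_image inj_on_def)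
qed

lemma signless_laplacian_mult:
  fixes G :: "'a::finite pair_pre_digraph"
  shows "(signless_laplacian G *v x) $ v = deg G v * x $ v + (\<Sum>w\<in>neighbours G v. x $ w)"
proof -
  have "(signless_laplacian G *v x) $ v =
    (\<Sum>w\<in>UNIV. (if v = w then deg G v * x $ w else 0) + (if (v, w) \<in> parcs G then x $ w else 0))"
    unfolding matrix_vector_mult_def vec_lambda_beta
    by (intro sum.cong refl)
      (simp add: signless_laplacian_def degree_matrix_def adjacency_matrix_def
        out_degree_with_proj distrib_right)
  also have "\<dots> = deg G v * x $ v + (\<Sum>w\<in>neighbours G v. x $ w)"
    by (simp add: sum.distrib neighbours_def sum.If_cases)
  finally show ?thesis .
qed

text \<open>Applied to the all-ones vector \<open>j\<close>, the criterion uses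
  \<open>Q j = 2 d\<close> and \<open>Q (Q j) = 2 (d^2 + s)\<close>, with \<open>d\<close> the
  degrees and \<open>s\<close> the sums of neighbour degrees. Thus \<open>j\<close> is an
  eigenvector iff the graph is regular.\<close>

lemma card_main_signless_laplacian_eigenvalues:
  fixes G :: "'a::finite pair_pre_digraph"
  assumes "sym (parcs G)"
  shows "card {\<mu>. main_signless_laplacian_eigenvalue G \<mu>} = 2 \<longleftrightarrow>
    (\<nexists>c. \<forall>v. deg G v = c) \<and>
    (\<exists>(a::real) (b::real). \<forall>v. real (nbr_deg_sum G v) = a * deg G v + b - (deg G v)\<^sup>2)"
proof -
  let ?Q = "signless_laplacian G"
  let ?f = "\<lambda>x. ?Q *v x"
  let ?j = "1 :: real ^ 'a"
  have "transpose ?Q = ?Q"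
    using assms by (auto simp: vec_eq_iff transpose_def signless_laplacian_def degree_matrix_def
        adjacency_matrix_def sym_def)
  then have adj: "?f x \<bullet> y = x \<bullet> ?f y" for x y
    by (metis dot_lmul_matrix vector_transpose_matrix)
  have sum_j: "(\<Sum>v\<in>UNIV. x $ v) = x \<bullet> ?j" for x :: "real ^ 'a"
    by (simp add: inner_vec_def)
  have "main_signless_laplacian_eigenvalue G \<mu> \<longleftrightarrow> (\<exists>x. ?f x = \<mu> *\<^sub>R x \<and> x \<bullet> ?j \<noteq> 0)" for \<mu>
    unfolding main_signless_laplacian_eigenvalue_def is_eigenvector_def sum_j
    by (metis inner_zero_left)
  then have "card {\<mu>. main_signless_laplacian_eigenvalue G \<mu>} = 2 \<longleftrightarrow>
    (\<nexists>c. ?f ?j = c *\<^sub>R ?j) \<and> (\<exists>a b. ?f (?f ?j) = a *\<^sub>R ?f ?j + b *\<^sub>R ?j)"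
    using card_main_eigenvalues_eq_2_iff[OF matrix_vector_mul_linear adj, of ?j] by simp
  moreover have fj: "?f ?j $ v = 2 * deg G v" for v
    by (simp add: signless_laplacian_mult deg_def)
  have ffj: "?f (?f ?j) $ v = 2 * ((deg G v)\<^sup>2 + nbr_deg_sum G v)" for v
    by (simp add: signless_laplacian_mult[of G "?f ?j"] fj nbr_deg_sum_def power2_eq_square sum_distrib_left)
  have "(\<exists>c. ?f ?j = c *\<^sub>R ?j) \<longleftrightarrow> (\<exists>c. \<forall>v. deg G v = c)"
  proof
    assume "\<exists>c. ?f ?j = c *\<^sub>R ?j"
    then obtain c where "\<And>v. 2 * real (deg G v) = c" by (auto simp: vec_eq_iff fj)
    then have "deg G v = deg G w" for v w by (smt (verit) of_nat_eq_iff)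
    then show "\<exists>c. \<forall>v. deg G v = c" by blast
  next
    assume "\<exists>c. \<forall>v. deg G v = c"
    then obtain c where "\<forall>v. deg G v = c" by blast
    then have "?f ?j = (2 * real c) *\<^sub>R ?j" by (auto simp: vec_eq_iff fj)
    then show "\<exists>c. ?f ?j = c *\<^sub>R ?j" by blast
  qed
  moreover have "(\<exists>a b. ?f (?f ?j) = a *\<^sub>R ?f ?j + b *\<^sub>R ?j) \<longleftrightarrow>
    (\<exists>(a::real) (b::real). \<forall>v. real (nbr_deg_sum G v) = a * deg G v + b - (deg G v)\<^sup>2)" (is "?L \<longleftrightarrow> ?R")
  proof
    assume ?L
    then obtain a :: real and b :: real where "\<And>v. 2 * real ((deg G v)\<^sup>2 + nbr_deg_sum G v) = a * (2 * deg G v) + b"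
      by (auto simp: vec_eq_iff ffj fj)
    then have "\<forall>v. real (nbr_deg_sum G v) = a * deg G v + b / 2 - (deg G v)\<^sup>2"
      by (simp add: field_simps)
    then show ?R by blast
  next
    assume ?R
    then obtain a :: real and b :: real where ab: "\<And>v. real (nbr_deg_sum G v) = a * deg G v + b - (deg G v)\<^sup>2" by blast
    have "?f (?f ?j) = a *\<^sub>R ?f ?j + (2 * b) *\<^sub>R ?j"
      by (simp add: vec_eq_iff ffj fj ab)
    then show ?L by blast
  qed
  ultimately show ?thesis by simp
qed

section \<open>Isomorphisms as maps on vertices\<close>

text \<open>Arcs are pairs of vertices, so the action of an isomorphism on arcs is forced by its
  action on vertices.\<close>

lemma digraph_iso_with_proj_iff:
  "digraph_iso (with_proj G) (with_proj H) \<longleftrightarrow> pair_wf_digraph G \<and>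
    (\<exists>f. inj_on f (pverts G) \<and> pverts H = f ` pverts G \<and> parcs H = map_prod f f ` parcs G)"
    (is "?L \<longleftrightarrow> ?R")
proof
  assume ?L
  then obtain h where h: "pre_digraph.digraph_isomorphism (with_proj G) h"
    and H: "with_proj H = app_iso h (with_proj G)"
    unfolding digraph_iso_def by blast
  let ?f = "iso_verts h"
  have "pverts H = ?f ` pverts G" "parcs H = iso_arcs h ` parcs G" "iso_tail h = fst" "iso_head h = snd"
    using arg_cong[OF H, of verts] arg_cong[OF H, of arcs] arg_cong[OF H, of tail]
      arg_cong[OF H, of head] by simp_all
  moreover have "iso_arcs h a = map_prod ?f ?f a" if "a \<in> parcs G" for a
    using h that calculation by (auto simp: pre_digraph.digraph_isomorphism_def prod_eq_iff)
  ultimately have "pverts H = ?f ` pverts G \<and> parcs H = map_prod ?f ?f ` parcs G" by simp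
  with h show ?R
    by (auto simp: pre_digraph.digraph_isomorphism_def wf_digraph_wp_iff)
next
  assume ?R
  then interpret pair_wf_digraph G by blast
  from \<open>?R\<close> obtain f where f: "inj_on f (pverts G)" "pverts H = f ` pverts G"
    "parcs H = map_prod f f ` parcs G" by blast
  let ?h = "\<lparr>iso_verts = f, iso_arcs = map_prod f f, iso_head = snd, iso_tail = fst\<rparr>"
  have "parcs G \<subseteq> pverts G \<times> pverts G" by (auto dest: in_arcsD1 in_arcsD2)
  with map_prod_inj_on[OF f(1) f(1)] have "inj_on (map_prod f f) (parcs G)"
    by (rule inj_on_subset)
  then have "digraph_isomorphism ?h"
    using f(1) wf_digraph_axioms by (auto simp: digraph_isomorphism_def)
  moreover have "with_proj H = app_iso ?h (with_proj G)"
    using f(2,3) by (simp add: app_iso_def with_proj_def)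
  ultimately show ?L unfolding digraph_iso_def by blast
qed

text \<open>The map \<open>g\<close> runs against the isomorphism, from the model \<open>H\<close>
  to \<open>G\<close>: the vertices of a model are explicit, so a map defined on them is easy to
  write down.\<close>

lemma digraph_iso_with_projI:
  assumes "pair_wf_digraph G" and g: "bij_betw g (pverts H) (pverts G)"
    and H: "parcs H \<subseteq> pverts H \<times> pverts H"
    and adj: "\<And>u v. u \<in> pverts H \<Longrightarrow> v \<in> pverts H \<Longrightarrow> (g u, g v) \<in> parcs G \<longleftrightarrow> (u, v) \<in> parcs H"
  shows "digraph_iso (with_proj G) (with_proj H)"
proof -
  interpret pair_wf_digraph G by fact
  let ?f = "the_inv_into (pverts H) g"
  have f: "bij_betw ?f (pverts G) (pverts H)" using g by (rule bij_betw_the_inv_into)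
  have fg: "?f (g u) = u" if "u \<in> pverts H" for u
    using that g by (simp add: bij_betw_def the_inv_into_f_f)
  have "parcs H = map_prod ?f ?f ` parcs G"
  proof (intro set_eqI iffI)
    fix e assume e: "e \<in> parcs H"
    then obtain u v where uv: "u \<in> pverts H" "v \<in> pverts H" "e = (u, v)" using H by auto
    then have "(g u, g v) \<in> parcs G" using e adj by simp
    then show "e \<in> map_prod ?f ?f ` parcs G" using uv(3) fg[OF uv(1)] fg[OF uv(2)]
      by (intro image_eqI[of _ _ "(g u, g v)"]) auto
  next
    fix e assume "e \<in> map_prod ?f ?f ` parcs G"
    then obtain x y where xy: "(x, y) \<in> parcs G" "e = (?f x, ?f y)" by auto
    then obtain u v where "u \<in> pverts H" "v \<in> pverts H" "x = g u" "y = g v"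
      using g in_arcsD1 in_arcsD2 unfolding bij_betw_def by (metis imageE)
    then show "e \<in> parcs H" using xy adj fg by simp
  qed
  then show ?thesis
    using assms(1) f unfolding digraph_iso_with_proj_iff bij_betw_def by blast
qed

lemma digraph_iso_degrees:
  assumes "digraph_iso (with_proj G) (with_proj H)"
  obtains f where "bij_betw f (pverts G) (pverts H)"
    "\<forall>v\<in>pverts G. deg H (f v) = deg G v"
    "\<forall>v\<in>pverts G. nbr_deg_sum H (f v) = nbr_deg_sum G v"
proof -
  from assms interpret pair_wf_digraph G by (simp add: digraph_iso_with_proj_iff)
  obtain f where f: "inj_on f (pverts G)" "pverts H = f ` pverts G" "parcs H = map_prod f f ` parcs G"
    using assms by (auto simp: digraph_iso_with_proj_iff)
  have sub: "neighbours G v \<subseteq> pverts G" for v by (auto simp: neighbours_def dest: in_arcsD2)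
  have nb: "neighbours H (f v) = f ` neighbours G v" if "v \<in> pverts G" for v
    using that f(1) by (force simp: neighbours_def f(3) dest: inj_onD in_arcsD1)
  have inj: "inj_on f (neighbours G v)" for v
    using f(1) sub by (rule inj_on_subset)
  have dg: "deg H (f v) = deg G v" if "v \<in> pverts G" for v
    by (simp add: deg_def nb[OF that] card_image inj)
  moreover have "nbr_deg_sum H (f v) = nbr_deg_sum G v" if "v \<in> pverts G" for v
    unfolding nbr_deg_sum_def nb[OF that] sum.reindex[OF inj] o_def
    using sub dg by (intro sum.cong) auto
  ultimately show ?thesis using f(1,2) that by (auto simp: bij_betw_def)
qed

section \<open>Degrees in cycles with pendant vertices\<close>

text \<open>The predecessor on the cycle is written \<open>i + r - 1\<close> so that truncated
  subtraction does no harm at \<open>i = 0\<close>.\<close>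

lemma eq_Suc_mod_iff:
  fixes i j r :: nat
  assumes "i < r" "j < r"
  shows "i = (j + 1) mod r \<longleftrightarrow> j = (i + r - 1) mod r"
proof (cases "i = 0")
  case True
  then show ?thesis using assms by (cases "j + 1 = r") auto
next
  case False
  then have "(i + r - 1) mod r = i - 1" using assms by (simp add: mod_if)
  then show ?thesis using assms False by (cases "j + 1 = r") auto
qed

lemma attach_cycle_neighbours:
  assumes r: "r \<ge> 3" and i: "i < r"
  shows "neighbours (attach_pendants (cycle_graph r) p) (i, 0) =
      {((i + 1) mod r, 0), ((i + r - 1) mod r, 0)} \<union> Pair i ` {1..p i}"
    and "1 \<le> j \<Longrightarrow> j \<le> p i \<Longrightarrow> neighbours (attach_pendants (cycle_graph r) p) (i, j) = {(i, 0)}"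
  using assms eq_Suc_mod_iff[OF i]
  by (auto simp: neighbours_def attach_pendants_def cycle_graph_def)

text \<open>This is where \<open>r \<ge> 3\<close> matters: for \<open>r = 2\<close> successor and
  predecessor coincide.\<close>

lemma Suc_mod_neq_pred_mod:
  fixes i r :: nat
  assumes "r \<ge> 3" "i < r"
  shows "(i + 1) mod r \<noteq> (i + r - 1) mod r"
  using assms by (cases "i = 0"; cases "i + 1 = r") (auto simp: mod_if)

lemma attach_cycle_deg:
  assumes r: "r \<ge> 3" and i: "i < r"
  shows "deg (attach_pendants (cycle_graph r) p) (i, 0) = p i + 2"
    and "1 \<le> j \<Longrightarrow> j \<le> p i \<Longrightarrow> deg (attach_pendants (cycle_graph r) p) (i, j) = 1"
proof -
  show "deg (attach_pendants (cycle_graph r) p) (i, 0) = p i + 2"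
    unfolding deg_def attach_cycle_neighbours[OF assms]
    using Suc_mod_neq_pred_mod[OF assms]
    by (subst card_Un_disjoint) (auto simp: card_image inj_on_def)
qed (simp add: deg_def attach_cycle_neighbours[OF assms])

lemma attach_cycle_nbr_deg_sum:
  assumes r: "r \<ge> 3" and i: "i < r"
  shows "nbr_deg_sum (attach_pendants (cycle_graph r) p) (i, 0) =
      p i + p ((i + 1) mod r) + p ((i + r - 1) mod r) + 4"
    and "1 \<le> j \<Longrightarrow> j \<le> p i \<Longrightarrow> nbr_deg_sum (attach_pendants (cycle_graph r) p) (i, j) = p i + 2"
proof -
  let ?A = "attach_pendants (cycle_graph r) p"
  have "(\<Sum>w\<in>Pair i ` {1..p i}. deg ?A w) = (\<Sum>w\<in>Pair i ` {1..p i}. 1)"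
    using attach_cycle_deg(2)[OF assms] by (intro sum.cong) auto
  also have "\<dots> = p i" by (simp add: card_image inj_on_def)
  finally have "(\<Sum>w\<in>Pair i ` {1..p i}. deg ?A w) = p i" .
  then show "nbr_deg_sum ?A (i, 0) = p i + p ((i + 1) mod r) + p ((i + r - 1) mod r) + 4"
    unfolding nbr_deg_sum_def attach_cycle_neighbours[OF assms]
    using Suc_mod_neq_pred_mod[OF assms] assms
    by (subst sum.union_disjoint) (auto simp: attach_cycle_deg)
qed (simp add: nbr_deg_sum_def attach_cycle_neighbours[OF assms] attach_cycle_deg[OF assms])

lemma attach_cycle_cases:
  assumes "v \<in> pverts (attach_pendants (cycle_graph r) p)"
  obtains i where "i < r" "v = (i, 0)" | i j where "i < r" "1 \<le> j" "j \<le> p i" "v = (i, j)"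
  using assms by (auto simp: attach_pendants_def cycle_graph_def) (metis One_nat_def Suc_leI gr0I)

section \<open>The two families have exactly two main eigenvalues\<close>

text \<open>The criterion only involves degrees and sums of neighbour degrees, which isomorphisms
  preserve. It can thus be checked on \<open>H\<close>, whose vertex type need not be
  finite.\<close>

lemma two_main_if_iso:
  fixes G :: "'a::finite pair_pre_digraph" and a b :: real
  assumes G: "pair_graph G" "pverts G = UNIV" and iso: "digraph_iso (with_proj G) (with_proj H)"
    and lin: "\<And>v. v \<in> pverts H \<Longrightarrow> real (nbr_deg_sum H v) = a * deg H v + b - (deg H v)\<^sup>2"
    and ne: "u \<in> pverts H" "v \<in> pverts H" "deg H u \<noteq> deg H v"
  shows "card {\<mu>. main_signless_laplacian_eigenvalue G \<mu>} = 2"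
proof -
  interpret pair_graph G by fact
  obtain f where f: "bij_betw f (pverts G) (pverts H)"
    "\<forall>v\<in>pverts G. deg H (f v) = deg G v"
    "\<forall>v\<in>pverts G. nbr_deg_sum H (f v) = nbr_deg_sum G v"
    by (rule digraph_iso_degrees[OF iso])
  have "sym (parcs G)" using arcs_symmetric by (auto intro: symI)
  moreover have "\<nexists>c. \<forall>v. deg G v = c"
    using ne f(1,2) unfolding bij_betw_def G by (metis UNIV_I imageE)
  moreover have "real (nbr_deg_sum G v) = a * deg G v + b - (deg G v)\<^sup>2" for v
  proof -
    have "f v \<in> pverts H" using f(1) G by (auto simp: bij_betw_def)
    from lin[OF this] show ?thesis using f(2,3) G by simp
  qed
  ultimately show ?thesis using card_main_signless_laplacian_eigenvalues by blast
qed

lemma two_main_if_G1: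
  fixes G :: "'a::finite pair_pre_digraph"
  assumes "pair_graph G" "pverts G = UNIV" and rk: "r \<ge> 3" "k \<ge> 1"
    and "digraph_iso (with_proj G) (with_proj (G1 r k))"
  shows "card {\<mu>. main_signless_laplacian_eigenvalue G \<mu>} = 2"
proof (rule two_main_if_iso[OF assms(1,2,5)])
  fix v assume "v \<in> pverts (G1 r k)"
  \<comment> \<open>The constants solve \<open>a + b - 1 = k + 2\<close> at the leaves and
    \<open>a (k + 2) + b - (k + 2)^2 = 3 k + 4\<close> on the cycle.\<close>
  then show "real (nbr_deg_sum (G1 r k) v) = (k + 5) * real (deg (G1 r k) v) + (-2) - (deg (G1 r k) v)\<^sup>2"
    unfolding G1_def using rk(1)
    by (elim attach_cycle_cases)
      (auto simp: attach_cycle_deg attach_cycle_nbr_deg_sum power2_eq_square algebra_simps)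
next
  show "(0, 0) \<in> pverts (G1 r k)" "(0, 1) \<in> pverts (G1 r k)"
    using rk by (auto simp: G1_def attach_pendants_def cycle_graph_def)
  show "deg (G1 r k) (0, 0) \<noteq> deg (G1 r k) (0, 1)"
    using rk by (simp add: G1_def attach_cycle_deg)
qed

lemma G2_pendants_eq:
  fixes i t :: nat
  shows "i < 3 * t \<Longrightarrow> (if \<exists>s<t. i = 3 * s then 1 else 0 :: nat) = (if 3 dvd i then 1 else 0)"
  by (auto elim!: dvdE)

lemma attach_pendants_cong:
  assumes "\<And>v. v \<in> pverts G \<Longrightarrow> p v = q v"
  shows "attach_pendants G p = attach_pendants G q"
  using assms unfolding attach_pendants_def by (auto 0 3)

lemma G2_conv: "G2 t = attach_pendants (cycle_graph (3 * t)) (\<lambda>i. if 3 dvd i then 1 else 0)"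
  unfolding G2_def by (rule attach_pendants_cong) (simp add: G2_pendants_eq cycle_graph_def)

lemma two_main_if_G2:
  fixes G :: "'a::finite pair_pre_digraph"
  assumes "pair_graph G" "pverts G = UNIV" and t: "t \<ge> 1"
    and "digraph_iso (with_proj G) (with_proj (G2 t))"
  shows "card {\<mu>. main_signless_laplacian_eigenvalue G \<mu>} = 2"
proof (rule two_main_if_iso[OF assms(1,2,4)])
  have t3: "3 * t \<ge> 3" using t by simp
  fix v assume v: "v \<in> pverts (G2 t)"
  \<comment> \<open>Reduction modulo \<open>3 * t\<close> does not affect divisibility by 3, so
    wrapping around the cycle needs no separate case.\<close>
  have dvd: "3 dvd (i + 1) mod (3 * t) \<longleftrightarrow> i mod 3 = 2"
    "3 dvd (i + 3 * t - 1) mod (3 * t) \<longleftrightarrow> i mod 3 = 1" if "i < 3 * t" for i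
  proof -
    show "3 dvd (i + 1) mod (3 * t) \<longleftrightarrow> i mod 3 = 2"
    proof -
      have "3 dvd (i + 1) mod (3 * t) \<longleftrightarrow> 3 dvd i + 1" by (rule dvd_mod_iff) simp
      also have "\<dots> \<longleftrightarrow> i mod 3 = 2" by presburger
      finally show ?thesis .
    qed
    have "3 dvd (i + 3 * t - 1) mod (3 * t) \<longleftrightarrow> 3 dvd i + 3 * t - 1"
      by (rule dvd_mod_iff) simp
    also have "\<dots> \<longleftrightarrow> i mod 3 = 1" using t by presburger
    finally show "3 dvd (i + 3 * t - 1) mod (3 * t) \<longleftrightarrow> i mod 3 = 1" .
  qed
  from v[unfolded G2_conv]
  \<comment> \<open>Degrees 1, 2 and 3 have neighbour degree sums 3, 5 and 5; \<open>a = 5\<close>,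
    \<open>b = -1\<close> fit all three.\<close>
  show "real (nbr_deg_sum (G2 t) v) = 5 * real (deg (G2 t) v) + (-1) - (deg (G2 t) v)\<^sup>2"
  proof (cases rule: attach_cycle_cases)
    case (1 i)
    consider "i mod 3 = 0" | "i mod 3 = 1" | "i mod 3 = 2" by fastforce
    then show ?thesis
      unfolding 1(2) G2_conv attach_cycle_deg(1)[OF t3 1(1)] attach_cycle_nbr_deg_sum(1)[OF t3 1(1)] dvd[OF 1(1)]
      by cases (simp_all add: dvd_eq_mod_eq_0)
  next
    case (2 i j)
    then show ?thesis
      by (simp add: G2_conv attach_cycle_deg[OF t3] attach_cycle_nbr_deg_sum[OF t3] split: if_splits)
  qed
next
  have t3: "3 * t \<ge> 3" using t by simp
  show "(0, 0) \<in> pverts (G2 t)" "(0, 1) \<in> pverts (G2 t)"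
    using t by (auto simp: G2_conv attach_pendants_def cycle_graph_def)
  show "deg (G2 t) (0, 0) \<noteq> deg (G2 t) (0, 1)"
    using t t3 by (simp add: G2_conv attach_cycle_deg)
qed

section \<open>Structure of unicyclic graphs\<close>

text \<open>When the new first vertex already lies on the path, the part before its occurrence is
  cut off. The bound on \<open>set p\<close> shows later that a path avoids a vertex.\<close>

lemma rtrancl_distinct_path:
  assumes "(x, y) \<in> R\<^sup>*"
  obtains p where "p \<noteq> []" "hd p = x" "last p = y" "distinct p"
    "successively (\<lambda>a b. (a, b) \<in> R) p" "set p \<subseteq> insert x (Range R)"
  using assms
proof (induction arbitrary: thesis rule: converse_rtrancl_induct)
  case base
  show ?case by (rule base[of "[y]"]) auto
next
  case (step x z)
  from step.IH obtain p where p: "p \<noteq> []" "hd p = z" "last p = y" "distinct p"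
    "successively (\<lambda>a b. (a, b) \<in> R) p" "set p \<subseteq> insert z (Range R)" .
  show ?case
  proof (cases "x \<in> set p")
    case True
    then obtain p1 p2 where "p = p1 @ x # p2" by (meson split_list)
    with p have "last (x # p2) = y" "distinct (x # p2)" "set (x # p2) \<subseteq> insert x (Range R)"
      "successively (\<lambda>a b. (a, b) \<in> R) (x # p2)" using step.hyps(1)
      by (auto simp: successively_append_iff split: if_splits)
    then show ?thesis using step.prems[of "x # p2"] by simp
  next
    case False
    have "successively (\<lambda>a b. (a, b) \<in> R) (x # p)"
      using p(1,2,5) step.hyps(1) by (cases p) auto
    moreover have "set (x # p) \<subseteq> insert x (Range R)" using p(6) step.hyps(1) by auto
    ultimately show ?thesis
      using step.prems[of "x # p"] p False by simp
  qed
qed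

text \<open>
  The cycle is a periodic sequence \<open>c\<close> with period \<open>r\<close>. Its uniqueness is only needed for the vertex set
  of a second cycle, given as a list of vertices.
\<close>

locale unicyclic_graph = pair_graph G
  for G :: "'a::finite pair_pre_digraph" and c :: "nat \<Rightarrow> 'a" and r :: nat +
  assumes verts_UNIV: "pverts G = UNIV"
    and r_ge_3: "r \<ge> 3"
    and c_eq_iff: "c i = c j \<longleftrightarrow> i mod r = j mod r"
    and c_adj: "(c i, c (Suc i)) \<in> parcs G"
    and connected: "(u, v) \<in> (parcs G)\<^sup>*"
    and closed_path_unique: "distinct p \<Longrightarrow> length p \<ge> 3 \<Longrightarrow>
      successively (\<lambda>u v. (u, v) \<in> parcs G) p \<Longrightarrow> (last p, hd p) \<in> parcs G \<Longrightarrow> set p = range c"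

section \<open>From the unique cycle to a periodic sequence\<close>

lemma closed_path_is_cycle:
  fixes G :: "'a pair_pre_digraph"
  assumes "pair_graph G" and p: "distinct p" "length p \<ge> 3"
      "successively (\<lambda>u v. (u, v) \<in> parcs G) p" "(last p, hd p) \<in> parcs G"
  obtains H where "is_cycle_of H G" "pverts H = set p"
proof -
  interpret pair_graph G by fact
  let ?n = "length p"
  \<comment> \<open>Taking the image of the arcs of the cycle, and not the induced subgraph, leaves
    out chords of \<open>p\<close>.\<close>
  define H where "H = \<lparr>pverts = set p, parcs = map_prod ((!) p) ((!) p) ` parcs (cycle_graph ?n)\<rparr>"
  have "p \<noteq> []" using p(2) by auto
  have adj: "(p ! i, p ! ((i + 1) mod ?n)) \<in> parcs G" if "i < ?n" for i
  proof (cases "i + 1 = ?n")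
    case True
    then have "i = ?n - 1" by simp
    then have "p ! i = last p" "p ! ((i + 1) mod ?n) = hd p"
      using \<open>p \<noteq> []\<close> by (simp_all add: last_conv_nth hd_conv_nth True)
    then show ?thesis using p(4) by simp
  next
    case False
    then show ?thesis using that p(3) by (simp add: successively_conv_nth)
  qed
  have sub: "parcs H \<subseteq> parcs G"
    using adj by (auto simp: H_def cycle_graph_def intro: arcs_symmetric)
  have wfH: "pair_wf_digraph H"
    by unfold_locales (auto simp: H_def cycle_graph_def)
  have "set p \<subseteq> pverts G"
  proof
    fix x assume "x \<in> set p"
    then obtain i where "i < ?n" "x = p ! i" by (auto simp: in_set_conv_nth)
    then show "x \<in> pverts G" using adj in_arcsD1 by blast
  qed
  then have "subgraph (with_proj H) (with_proj G)"
    using sub wfH wf_digraph by (simp add: subgraph_def wf_digraph_wp_iff H_def compatibleI_with_proj)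
  moreover have "digraph_iso (with_proj H) (with_proj (cycle_graph ?n))"
  proof (rule digraph_iso_with_projI[OF wfH])
    show "bij_betw ((!) p) (pverts (cycle_graph ?n)) (pverts H)"
      using p(1) by (simp add: bij_betw_nth H_def cycle_graph_def)
    show "parcs (cycle_graph ?n) \<subseteq> pverts (cycle_graph ?n) \<times> pverts (cycle_graph ?n)"
      by (auto simp: cycle_graph_def)
    fix i j assume "i \<in> pverts (cycle_graph ?n)" "j \<in> pverts (cycle_graph ?n)"
    then have ij: "i < ?n" "j < ?n" by (auto simp: cycle_graph_def)
    show "(p ! i, p ! j) \<in> parcs H \<longleftrightarrow> (i, j) \<in> parcs (cycle_graph ?n)"
    proof
      assume "(p ! i, p ! j) \<in> parcs H"
      then obtain i' j' where *: "p ! i = p ! i'" "p ! j = p ! j'" "(i', j') \<in> parcs (cycle_graph ?n)"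
        by (auto simp: H_def)
      then have "i' < ?n" "j' < ?n" by (auto simp: cycle_graph_def)
      then show "(i, j) \<in> parcs (cycle_graph ?n)"
        using * ij p(1) by (simp add: nth_eq_iff_index_eq)
    next
      assume "(i, j) \<in> parcs (cycle_graph ?n)"
      then show "(p ! i, p ! j) \<in> parcs H" by (force simp: H_def)
    qed
  qed
  ultimately have "is_cycle_of H G" using p(2) by (auto simp: is_cycle_of_def)
  then show ?thesis using that by (simp add: H_def)
qed

text \<open>The sequence \<open>c\<close> is the inverse of the isomorphism onto
  \<open>cycle_graph r\<close>, extended periodically. Any closed path spans a cycle, which
  uniqueness identifies with \<open>H\<close>.\<close>

lemma unicyclic_obtain_cycle:
  fixes G :: "'a::finite pair_pre_digraph"
  assumes "pair_graph G" "pverts G = UNIV" "unicyclic G"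
  obtains c r where "unicyclic_graph G c r"
proof -
  interpret pair_graph G by fact
  from assms(3) obtain H where H: "is_cycle_of H G" and uniq: "\<And>H'. is_cycle_of H' G \<Longrightarrow> H' = H"
    unfolding unicyclic_def by blast
  from H obtain r where r: "r \<ge> 3" and sub: "subgraph (with_proj H) (with_proj G)"
    and "digraph_iso (with_proj H) (with_proj (cycle_graph r))"
    by (auto simp: is_cycle_of_def)
  then obtain f where f: "inj_on f (pverts H)" "{..<r} = f ` pverts H"
    "parcs (cycle_graph r) = map_prod f f ` parcs H" and wfH: "pair_wf_digraph H"
    by (auto simp: digraph_iso_with_proj_iff cycle_graph_def)
  interpret H: pair_wf_digraph H by (rule wfH)
  define g where "g = the_inv_into (pverts H) f"
  have gf: "g (f v) = v" if "v \<in> pverts H" for v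
    using f(1) that by (simp add: g_def the_inv_into_f_f)
  have fg: "f (g i) = i" "g i \<in> pverts H" if "i < r" for i
    using that f(2) gf by (metis imageE lessThan_iff)+
  define c where "c i = g (i mod r)" for i
  have r0: "r > 0" using r by simp
  have range_c: "range c = pverts H"
  proof (intro set_eqI iffI)
    fix v assume v: "v \<in> pverts H"
    then have "f v < r" using f(2) by auto
    then have "v = c (f v)" using gf[OF v] by (simp add: c_def)
    then show "v \<in> range c" by simp
  qed (use fg r0 in \<open>auto simp: c_def\<close>)
  show ?thesis
  proof (rule that, unfold_locales)
    show "pverts G = UNIV" "r \<ge> 3" by fact+
    show "c i = c j \<longleftrightarrow> i mod r = j mod r" for i j
      unfolding c_def by (metis fg(1) mod_less_divisor r0)
    show "(c i, c (Suc i)) \<in> parcs G" for i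
    proof -
      have "(i mod r, Suc i mod r) \<in> parcs (cycle_graph r)"
        using r0 by (simp add: cycle_graph_def mod_Suc_eq)
      then obtain u v where uv: "(u, v) \<in> parcs H" "i mod r = f u" "Suc i mod r = f v"
        unfolding f(3) by auto
      then have "c i = u" "c (Suc i) = v"
        unfolding c_def using gf H.in_arcsD1 H.in_arcsD2 by auto
      then show ?thesis using uv(1) sub by (auto simp: subgraph_def)
    qed
    show "(u, v) \<in> (parcs G)\<^sup>*" for u v
    proof -
      \<comment> \<open>Connectedness is defined through the symmetric closure; for a symmetric
        digraph it gives directed reachability.\<close>
      have "strongly_connected (with_proj G)"
        using assms(3) symmetric_connected_imp_strongly_connected sym_arcs by (simp add: unicyclic_def)
      then have "u \<rightarrow>\<^sup>*\<^bsub>with_proj G\<^esub> v" by (simp add: strongly_connected_def assms(2))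
      then show ?thesis using reachable_rtranclI by fastforce
    qed
    show "set p = range c" if "distinct p" "length p \<ge> 3"
      "successively (\<lambda>u v. (u, v) \<in> parcs G) p" "(last p, hd p) \<in> parcs G" for p
      using closed_path_is_cycle[OF assms(1) that] uniq range_c by metis
  qed
qed

section \<open>Chords and detours would create a second cycle\<close>

context unicyclic_graph
begin

text \<open>Modulo \<open>r\<close>, a shift by \<open>k * (r - 1)\<close> undoes a shift by
  \<open>k\<close>.\<close>

lemma c_unshift: "c (i + k * (r - 1) + k) = c i"
proof -
  have "i + k * (r - 1) + k = i + k * r" using r_ge_3 by (cases r) auto
  then have "(i + k * (r - 1) + k) mod r = i mod r" by (metis mod_mult_self1)
  then show ?thesis by (simp only: c_eq_iff)
qed

lemma range_c_shift: "range (\<lambda>i. c (i + k)) = range c"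
  using c_unshift[of _ k] by (auto simp: image_iff) metis

text \<open>This allows any chosen cycle vertex to be numbered 0.\<close>

lemma unicyclic_graph_shift: "unicyclic_graph G (\<lambda>i. c (i + k)) r"
proof unfold_locales
  show "c (i + k) = c (j + k) \<longleftrightarrow> i mod r = j mod r" for i j
    unfolding c_eq_iff
  proof
    assume "(i + k) mod r = (j + k) mod r"
    then have "(i + k + k * (r - 1)) mod r = (j + k + k * (r - 1)) mod r"
      by (rule mod_add_cong) simp
    then have "c (i + k * (r - 1) + k) = c (j + k * (r - 1) + k)"
      by (simp add: c_eq_iff algebra_simps)
    then show "i mod r = j mod r" unfolding c_unshift by (simp only: c_eq_iff)
  qed (rule mod_add_cong[OF _ refl])
  show "set p = range (\<lambda>i. c (i + k))" if "distinct p" "length p \<ge> 3"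
      "successively (\<lambda>u v. (u, v) \<in> parcs G) p" "(last p, hd p) \<in> parcs G" for p
    using closed_path_unique[OF that] by (simp add: range_c_shift)
qed (use verts_UNIV r_ge_3 connected c_adj in auto)

lemma c_mod [simp]: "c (i mod r) = c i"
  by (simp add: c_eq_iff)

lemma range_cE:
  assumes "v \<in> range c"
  obtains i where "i < r" "v = c i"
proof -
  from assms obtain j where "v = c j" by auto
  then show ?thesis using that[of "j mod r"] r_ge_3 by simp
qed

lemma inj_on_c: "inj_on c {..<r}"
  by (rule inj_onI) (simp add: c_eq_iff)

text \<open>The stretch from \<open>c i\<close> to \<open>c j\<close> is closed up by the edge
  between its ends. Unless the two are adjacent on it, uniqueness makes it the whole cycle, so it
  contains both \<open>c 0\<close> and \<open>c (r - 1)\<close>.\<close>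

lemma chord:
  assumes "i < j" "j < r" "(c i, c j) \<in> parcs G"
  shows "j = i + 1 \<or> (i = 0 \<and> j = r - 1)"
proof (rule ccontr)
  assume *: "\<not> ?thesis"
  let ?p = "map c [i..<Suc j]"
  from inj_on_c have "inj_on c {i..<Suc j}" by (rule inj_on_subset) (use assms in auto)
  then have "distinct ?p" by (simp add: distinct_map del: upt_Suc)
  moreover have "length ?p \<ge> 3" using assms * by (simp; linarith)
  moreover have "successively (\<lambda>u v. (u, v) \<in> parcs G) ?p"
    unfolding successively_conv_nth using c_adj by (auto simp del: upt_Suc)
  moreover have "last ?p = c j" "hd ?p = c i"
    using assms by (simp_all add: last_map hd_map hd_append)
  ultimately have "set ?p = range c"
    using assms(3) arcs_symmetric by (intro closed_path_unique) auto
  then have "c 0 \<in> c ` {i..j}" "c (r - 1) \<in> c ` {i..j}"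
    by (auto simp: atLeastLessThanSuc_atLeastAtMost simp del: upt_Suc)
  then have "i = 0" "j = r - 1"
    using assms by (auto simp: c_eq_iff)
  with * show False by simp
qed

lemma cycle_nbrs:
  assumes i: "i < r"
  shows "neighbours G (c i) \<inter> range c = {c (i + 1), c (i + r - 1)}"
proof (intro equalityI subsetI)
  fix v assume "v \<in> neighbours G (c i) \<inter> range c"
  then obtain j where j: "j < r" "v = c j" "(c i, c j) \<in> parcs G"
    by (auto simp: neighbours_def elim!: range_cE[of v])
  have "i \<noteq> j" using j no_loops' by blast
  then consider "i < j" | "j < i" by linarith
  then have "j = (i + 1) mod r \<or> j = (i + r - 1) mod r"
  proof cases
    case 1
    from chord[OF this j(1,3)] j(1) show ?thesis by auto
  next
    case 2
    from chord[OF this i] j(3) arcs_symmetric have "i = j + 1 \<or> j = 0 \<and> i = r - 1" by blast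
    then show ?thesis using i by auto
  qed
  then show "v \<in> {c (i + 1), c (i + r - 1)}" using j(2) by auto
next
  fix v assume "v \<in> {c (i + 1), c (i + r - 1)}"
  moreover have "(c (i + r - 1), c i) \<in> parcs G"
  proof -
    have "c (Suc (i + r - 1)) = c i" using r_ge_3 by (simp add: c_eq_iff)
    then show ?thesis using c_adj[of "i + r - 1"] by simp
  qed
  ultimately show "v \<in> neighbours G (c i) \<inter> range c"
    using c_adj[of i] arcs_symmetric by (auto simp: neighbours_def)
qed

lemma c_succ_neq_pred: "c (i + 1) \<noteq> c (i + r - 1)"
proof -
  have "(i + 1) mod r = (i mod r + 1) mod r" by (simp add: mod_Suc_eq)
  moreover have "(i + r - 1) mod r = (i mod r + r - 1) mod r"
    using r_ge_3 mod_add_left_eq[of i r "r - 1"] by (simp add: add.commute)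
  ultimately show ?thesis
    using Suc_mod_neq_pred_mod[OF r_ge_3, of "i mod r"] r_ge_3 by (simp add: c_eq_iff)
qed

text \<open>A path from \<open>u1\<close> to \<open>u2\<close> avoiding \<open>v\<close> would close
  up through \<open>v\<close> to a cycle containing the vertex \<open>v\<close>, which is off the
  cycle.\<close>

lemma no_detour:
  assumes v: "v \<notin> range c" and u: "(v, u1) \<in> parcs G" "(v, u2) \<in> parcs G" "u1 \<noteq> u2"
  shows "(u1, u2) \<notin> {(a, b). (a, b) \<in> parcs G \<and> a \<noteq> v \<and> b \<noteq> v}\<^sup>*"
proof
  assume "(u1, u2) \<in> {(a, b). (a, b) \<in> parcs G \<and> a \<noteq> v \<and> b \<noteq> v}\<^sup>*" (is "_ \<in> ?R\<^sup>*")
  then obtain p where p: "p \<noteq> []" "hd p = u1" "last p = u2" "distinct p"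
    "successively (\<lambda>a b. (a, b) \<in> ?R) p" "set p \<subseteq> insert u1 (Range ?R)"
    by (rule rtrancl_distinct_path)
  have "u1 \<noteq> v" using u(1) no_loops' by blast
  then have "distinct (v # p)" using p(4,6) by auto
  moreover have "length (v # p) \<ge> 3" using p(1,2,3) u(3) by (cases p; cases "tl p") auto
  moreover have "successively (\<lambda>u v. (u, v) \<in> parcs G) p"
    using p(5) by (rule successively_mono) auto
  then have "successively (\<lambda>u v. (u, v) \<in> parcs G) (v # p)"
    using p(1,2) u(1) by (cases p) auto
  moreover have "(last (v # p), hd (v # p)) \<in> parcs G"
    using p(1,3) u(2) arcs_symmetric by simp
  ultimately have "set (v # p) = range c" by (rule closed_path_unique)
  then show False using v by auto
qed

section \<open>Distance to the cycle, parents and children\<close>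

text \<open>The distance to the cycle, as the least length of a walk to it; connectedness provides
  such a walk.\<close>

definition depth :: "'a \<Rightarrow> nat" where
  "depth v = (LEAST n. \<exists>i. (v, c i) \<in> parcs G ^^ n)"

lemma depth_le: "(v, c i) \<in> parcs G ^^ n \<Longrightarrow> depth v \<le> n"
  unfolding depth_def by (rule Least_le) blast

lemma depth_path: "\<exists>i. (v, c i) \<in> parcs G ^^ depth v"
proof -
  obtain n where "(v, c 0) \<in> parcs G ^^ n" using connected rtrancl_imp_relpow by blast
  then have "\<exists>i. (v, c i) \<in> parcs G ^^ n" by blast
  then show ?thesis
    unfolding depth_def by (rule LeastI[where P = "\<lambda>n. \<exists>i. (v, c i) \<in> parcs G ^^ n"])
qed

lemma depth_eq_0_iff: "depth v = 0 \<longleftrightarrow> v \<in> range c"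
  using depth_path[of v] depth_le[of v _ 0] by auto

lemma depth_adj:
  assumes "(u, v) \<in> parcs G"
  shows "depth u \<le> Suc (depth v)"
proof -
  obtain i where "(v, c i) \<in> parcs G ^^ depth v" using depth_path[of v] by blast
  with assms have "(u, c i) \<in> parcs G ^^ Suc (depth v)" by (rule relpow_Suc_I2)
  then show ?thesis by (rule depth_le)
qed

lemma depth_Suc_obtain:
  assumes "depth v = Suc n"
  obtains u where "(v, u) \<in> parcs G" "depth u = n"
proof -
  obtain i where "(v, c i) \<in> parcs G ^^ Suc n" using depth_path[of v] assms by auto
  then obtain u where u: "(v, u) \<in> parcs G" "(u, c i) \<in> parcs G ^^ n"
    by (meson relpow_Suc_D2)
  then have "depth u = n" using depth_le[OF u(2)] depth_adj[OF u(1)] assms by simp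
  then show ?thesis using u that by blast
qed

text \<open>Descending from \<open>u\<close>, every further vertex is strictly closer to the cycle
  than \<open>v\<close>, hence different from \<open>v\<close>; the rest of the path runs along the
  cycle.\<close>

lemma path_to_cycle_avoiding:
  assumes v: "v \<notin> range c" and "u \<noteq> v" "depth u \<le> depth v"
  shows "(u, c 0) \<in> {(a, b). (a, b) \<in> parcs G \<and> a \<noteq> v \<and> b \<noteq> v}\<^sup>*" (is "_ \<in> ?R\<^sup>*")
  using assms(2,3)
proof (induction "depth u" arbitrary: u)
  case 0
  then have "u \<in> range c" using depth_eq_0_iff by simp
  then obtain i where "u = c i" by auto
  moreover have "(c i, c 0) \<in> ?R\<^sup>*" for i
  proof (induction i)
    case (Suc i)
    have "(c (Suc i), c i) \<in> ?R" using c_adj[of i] v by (auto intro: arcs_symmetric)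
    with Suc show ?case by (rule converse_rtrancl_into_rtrancl[rotated])
  qed simp
  ultimately show ?case by simp
next
  case (Suc n)
  then obtain w where w: "(u, w) \<in> parcs G" "depth w = n" by (metis depth_Suc_obtain)
  with Suc have "w \<noteq> v" by auto
  moreover have "(w, c 0) \<in> ?R\<^sup>*" using Suc w \<open>w \<noteq> v\<close> by simp
  ultimately show ?case using w Suc.prems by (auto intro: converse_rtrancl_into_rtrancl)
qed

text \<open>Two such neighbours would be joined via \<open>c 0\<close> by a path avoiding
  \<open>v\<close>, a detour. Equality of depths is allowed, which excludes edges within a
  level.\<close>

lemma parent_unique:
  assumes "v \<notin> range c" and u: "(v, u1) \<in> parcs G" "(v, u2) \<in> parcs G"
    and "depth u1 \<le> depth v" "depth u2 \<le> depth v"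
  shows "u1 = u2"
proof (rule ccontr)
  assume "u1 \<noteq> u2"
  let ?R = "{(a, b). (a, b) \<in> parcs G \<and> a \<noteq> v \<and> b \<noteq> v}"
  have "u1 \<noteq> v" "u2 \<noteq> v" using u no_loops' by blast+
  then have "(u1, c 0) \<in> ?R\<^sup>*" "(u2, c 0) \<in> ?R\<^sup>*" using assms path_to_cycle_avoiding by auto
  moreover have "sym ?R" using arcs_symmetric by (auto intro: symI)
  ultimately have "(u1, u2) \<in> ?R\<^sup>*" by (meson rtrancl_trans sym_rtrancl symE)
  then show False using no_detour[OF assms(1) u \<open>u1 \<noteq> u2\<close>] by blast
qed

definition children :: "'a \<Rightarrow> 'a set" where
  "children v = {w \<in> neighbours G v. depth w = Suc (depth v)}"

text \<open>Depths of adjacent vertices differ by at most 1, so a neighbour is a child or the only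
  neighbour that is no deeper than \<open>v\<close>.\<close>

lemma neighbours_off_cycle:
  assumes v: "v \<notin> range c"
  obtains z where "neighbours G v = insert z (children v)" "z \<notin> children v" "Suc (depth z) = depth v"
proof -
  have "depth v \<noteq> 0" using v depth_eq_0_iff by simp
  then obtain n where n: "depth v = Suc n" by (cases "depth v") auto
  then obtain z where z: "(v, z) \<in> parcs G" "depth z = n" by (rule depth_Suc_obtain)
  have "neighbours G v = insert z (children v)"
  proof (intro equalityI subsetI)
    fix w assume w: "w \<in> neighbours G v"
    then have vw: "(v, w) \<in> parcs G" by (simp add: neighbours_def)
    then have "depth w \<le> Suc (depth v)" using depth_adj arcs_symmetric by blast
    then consider "depth w \<le> depth v" | "depth w = Suc (depth v)" by linarith
    then show "w \<in> insert z (children v)"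
    proof cases
      case 1
      then have "w = z" using parent_unique[OF v vw z(1)] z(2) n by simp
      then show ?thesis by simp
    qed (use w in \<open>simp add: children_def\<close>)
  qed (use z in \<open>auto simp: children_def neighbours_def\<close>)
  moreover have "z \<notin> children v" using z n by (simp add: children_def)
  ultimately show ?thesis using that z n by simp
qed

lemma neighbours_on_cycle:
  assumes "i < r"
  shows "neighbours G (c i) = {c (i + 1), c (i + r - 1)} \<union> children (c i)"
    and "{c (i + 1), c (i + r - 1)} \<inter> children (c i) = {}"
proof -
  have d: "depth (c i) = 0" for i using depth_eq_0_iff by simp
  have "children (c i) = neighbours G (c i) - range c"
  proof (intro equalityI subsetI)
    fix w assume "w \<in> neighbours G (c i) - range c"
    then have w: "(c i, w) \<in> parcs G" "depth w \<noteq> 0" "w \<in> neighbours G (c i)"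
      by (auto simp: neighbours_def depth_eq_0_iff)
    then have "depth w \<le> 1" using depth_adj[of w "c i"] arcs_symmetric d by simp
    with w show "w \<in> children (c i)" by (simp add: children_def d)
  qed (auto simp: children_def d)
  then have "neighbours G (c i) = neighbours G (c i) \<inter> range c \<union> children (c i)" by blast
  then show "neighbours G (c i) = {c (i + 1), c (i + r - 1)} \<union> children (c i)"
    unfolding cycle_nbrs[OF assms] .
  show "{c (i + 1), c (i + r - 1)} \<inter> children (c i) = {}" by (auto simp: children_def d)
qed

lemma children_eq_empty:
  assumes "\<And>w. depth w \<le> depth v"
  shows "children v = {}"
proof (rule equals0I)
  fix w assume "w \<in> children v"
  with assms[of w] show False by (simp add: children_def)
qed

lemma children_parent: "w \<in> children v \<Longrightarrow> (w, v) \<in> parcs G"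
  by (auto simp: children_def neighbours_def intro: arcs_symmetric)

end

section \<open>Graphs satisfying the degree equation\<close>

text \<open>The equation at \<open>y\<close> when \<open>y\<close> lies off the cycle and its parent
  has degree \<open>z\<close>. It reads \<open>p * m = e\<^sup>2\<close>, whence
  \<open>1 \<le> m < e\<close>; but \<open>p \<le> e\<^sup>2\<close> makes \<open>m\<close> at least
  \<open>e\<close>.\<close>

lemma no_parent_off_cycle:
  fixes e p z :: int
  assumes "0 < e" "e < p" "1 \<le> z"
    and eq: "p * (z + e * (p + 1)) = p * (p + 1) + e * (p\<^sup>2 + e - e * p)"
  shows False
proof -
  define m where "m = e + z - p - 1 + e\<^sup>2"
  have pm: "p * m = e\<^sup>2" using eq by (simp add: m_def algebra_simps power2_eq_square)
  have "0 < p * m" using pm assms by simp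
  then have "1 \<le> m" using assms by (simp add: zero_less_mult_iff)
  have "p * m < p * e" using pm assms by (simp add: power2_eq_square)
  then have "m < e" using assms by simp
  have "p * 1 \<le> p * m" using \<open>1 \<le> m\<close> assms by (intro mult_left_mono) auto
  then have "p \<le> e\<^sup>2" using pm by simp
  then show False using \<open>m < e\<close> assms(3) m_def by simp
qed

text \<open>The equation at \<open>y\<close> when \<open>y\<close> lies on the cycle between
  vertices of degrees \<open>d1\<close> and \<open>d2\<close>. Again
  \<open>p * m = e\<^sup>2\<close> with \<open>1 \<le> m < e\<close>; size leaves only
  \<open>m = 1\<close>, so \<open>p = e\<^sup>2\<close>, and divisibility then forces
  \<open>e = 1 = p\<close>.\<close>

lemma no_branch_on_cycle:
  fixes e p d1 d2 :: int
  assumes "0 < e" "e < p" and d: "2 \<le> d1" "2 \<le> d2"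
    and dvd: "p dvd (d1 - 1) * e" "p dvd (d2 - 1) * e"
    and eq: "p * (d1 + d2 + (e - 1) * (p + 1)) = p * (p + 1) + e * (p\<^sup>2 + e - e * p)"
  shows False
proof -
  define m where "m = d1 + d2 - 2 * p + e - 2 + e\<^sup>2"
  have pm: "p * m = e\<^sup>2" using eq by (simp add: m_def algebra_simps power2_eq_square)
  have "0 < p * m" using pm assms by simp
  then have "1 \<le> m" using assms by (simp add: zero_less_mult_iff)
  have "p * m < p * e" using pm assms by (simp add: power2_eq_square)
  then have "m < e" using assms by simp
  have "m < 2"
  proof (rule ccontr)
    assume "\<not> m < 2"
    then have "p * 2 \<le> p * m" using assms by (intro mult_left_mono) auto
    then have "2 * p \<le> e\<^sup>2" using pm by simp
    then show False using \<open>m < e\<close> d m_def by simp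
  qed
  then have "m = 1" using \<open>1 \<le> m\<close> by simp
  then have p: "p = e * e" using pm by (simp add: power2_eq_square)
  have "e dvd d1 - 1" "e dvd d2 - 1"
    using dvd \<open>0 < e\<close> unfolding p by auto
  then have "e dvd (d1 - 1) + (d2 - 1)" by (rule dvd_add)
  moreover have "(d1 - 1) + (d2 - 1) = 1 + e * (e - 1)"
    using \<open>m = 1\<close> p by (simp add: m_def algebra_simps power2_eq_square)
  ultimately have "e dvd 1 + e * (e - 1)" by simp
  then have "e dvd 1" by (simp add: dvd_add_left_iff)
  then have "e = 1" using \<open>0 < e\<close> by simp
  then show False using p \<open>e < p\<close> by simp
qed

section \<open>Shallow unicyclic graphs as cycles with pendant vertices\<close>

context unicyclic_graph
begin

lemma c_adj_iff:
  assumes "i < r" "j < r"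
  shows "(c i, c j) \<in> parcs G \<longleftrightarrow> (i, j) \<in> parcs (cycle_graph r)"
proof -
  have "(c i, c j) \<in> parcs G \<longleftrightarrow> c j \<in> neighbours G (c i) \<inter> range c"
    by (simp add: neighbours_def)
  also have "\<dots> \<longleftrightarrow> j = (i + 1) mod r \<or> i = (j + 1) mod r"
    unfolding cycle_nbrs[OF assms(1)] using assms eq_Suc_mod_iff[OF assms] by (simp add: c_eq_iff)
  finally show ?thesis using assms by (simp add: cycle_graph_def)
qed

lemma range_c: "range c = c ` {..<r}"
proof (intro equalityI subsetI)
  fix v assume "v \<in> range c"
  then obtain i where "i < r" "v = c i" by (rule range_cE)
  then show "v \<in> c ` {..<r}" by simp
qed auto

lemma depth_c [simp]: "depth (c i) = 0"
  by (simp add: depth_eq_0_iff)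

text \<open>Used in contrapositive form: a graph other than a cycle has a vertex off its
  cycle.\<close>

lemma iso_cycle:
  assumes "range c = UNIV"
  shows "digraph_iso (with_proj G) (with_proj (cycle_graph (card (pverts G))))"
proof -
  have "card (pverts G) = r"
    using assms card_image[OF inj_on_c] by (simp add: verts_UNIV range_c)
  moreover have "digraph_iso (with_proj G) (with_proj (cycle_graph r))"
  proof (rule digraph_iso_with_projI)
    show "bij_betw c (pverts (cycle_graph r)) (pverts G)"
      using assms inj_on_c by (simp add: bij_betw_def verts_UNIV range_c cycle_graph_def)
  qed (auto simp: c_adj_iff cycle_graph_def pair_wf_digraph)
  ultimately show ?thesis by simp
qed

lemma deg_off_cycle: "v \<notin> range c \<Longrightarrow> deg G v = Suc (card (children v))"
  by (erule neighbours_off_cycle) (simp add: deg_def)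

lemma deg_on_cycle: "deg G (c i) = card (children (c i)) + 2"
proof -
  have "i mod r < r" using r_ge_3 by simp
  then have "deg G (c (i mod r)) = card (children (c (i mod r))) + 2"
    using neighbours_on_cycle[of "i mod r"] c_succ_neq_pred[of "i mod r"]
    by (subst deg_def) (simp add: card_Un_disjoint)
  then show ?thesis by simp
qed

lemma deg_ge_2:
  assumes "v \<in> range c \<or> children v \<noteq> {}"
  shows "deg G v \<ge> 2"
proof (cases "v \<in> range c")
  case False
  then show ?thesis using assms by (simp add: deg_off_cycle Suc_le_eq card_gt_0_iff)
qed (auto simp: deg_on_cycle)

text \<open>Centred at \<open>Suc i\<close>, so that the predecessor is simply
  \<open>c i\<close>.\<close>

lemma nbr_deg_sum_cycle:
  "nbr_deg_sum G (c (Suc i)) = deg G (c i) + deg G (c (i + 2)) + (\<Sum>w\<in>children (c (Suc i)). deg G w)"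
proof -
  let ?i = "Suc i mod r"
  have i: "?i < r" using r_ge_3 by simp
  have "c (?i + 1) = c (i + 2)" by (simp add: c_eq_iff mod_Suc_eq)
  moreover have "c (?i + r - 1) = c i"
  proof -
    have "?i + r - 1 = ?i + (r - 1)" using r_ge_3 by simp
    moreover have "(?i + (r - 1)) mod r = (Suc i + (r - 1)) mod r" by (simp add: mod_add_left_eq)
    moreover have "Suc i + (r - 1) = i + r" using r_ge_3 by simp
    ultimately show ?thesis by (simp add: c_eq_iff)
  qed
  ultimately have N: "neighbours G (c (Suc i)) = {c i, c (i + 2)} \<union> children (c (Suc i))"
    "{c i, c (i + 2)} \<inter> children (c (Suc i)) = {}" "c (i + 2) \<noteq> c i"
    using neighbours_on_cycle[OF i] c_succ_neq_pred[of ?i] by auto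
  then show ?thesis
    unfolding nbr_deg_sum_def N(1) by (subst sum.union_disjoint) auto
qed

text \<open>At depth 1 every vertex is a leaf hanging from a cycle vertex. Numbering the children of
  each \<open>c i\<close> from 1 matches the names that \<open>attach_pendants\<close> gives
  them.\<close>

lemma iso_attach_pendants:
  assumes shallow: "\<And>v. depth v \<le> 1"
  shows "digraph_iso (with_proj G)
    (with_proj (attach_pendants (cycle_graph r) (\<lambda>i. card (children (c i)))))"
    (is "digraph_iso _ (with_proj ?A)")
proof -
  let ?p = "\<lambda>i. card (children (c i))"
  have "\<exists>h. bij_betw h {1..?p i} (children (c i))" for i
    by (rule ex_bij_betw_nat_finite_1) simp
  then obtain h where h: "\<And>i. bij_betw (h i) {1..?p i} (children (c i))" by metis
  have hc: "h i j \<in> children (c i)" if "1 \<le> j" "j \<le> ?p i" for i j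
    using h[of i] that by (auto simp: bij_betw_def)
  have leaf: "neighbours G w = {c i}" "w \<notin> range c" if "w \<in> children (c i)" for w i
  proof -
    have d: "depth w = 1" using that by (simp add: children_def)
    then show off: "w \<notin> range c" by (simp flip: depth_eq_0_iff)
    have "children w = {}" using shallow d by (intro children_eq_empty) simp
    moreover have "c i \<in> neighbours G w" using children_parent[OF that] by (simp add: neighbours_def)
    ultimately show "neighbours G w = {c i}"
      using off by (elim neighbours_off_cycle) auto
  qed
  define g where "g = (\<lambda>(i, j). if j = 0 then c i else h i j)"
  have g0: "g (i, 0) = c i" for i by (simp add: g_def)
  have g1: "g (i, j) = h i j" "g (i, j) \<in> children (c i)" if "1 \<le> j" "j \<le> ?p i" for i j
    using that hc by (auto simp: g_def)
  show ?thesis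
  proof (rule digraph_iso_with_projI)
    show "pair_wf_digraph G" ..
    show "parcs ?A \<subseteq> pverts ?A \<times> pverts ?A"
      by (auto simp: attach_pendants_def cycle_graph_def)
    have "inj_on g (pverts ?A)"
    proof (rule inj_onI)
      fix u v assume u: "u \<in> pverts ?A" and v: "v \<in> pverts ?A" and eq: "g u = g v"
      from u show "u = v"
      proof (cases rule: attach_cycle_cases)
        case (1 i)
        from v show ?thesis
        proof (cases rule: attach_cycle_cases)
          case (1 i')
          then show ?thesis using eq \<open>u = (i, 0)\<close> \<open>i < r\<close> by (simp add: g0 c_eq_iff)
        next
          case (2 i' j')
          then have "g v \<notin> range c" using leaf(2)[OF g1(2)] by simp
          then show ?thesis using eq \<open>u = (i, 0)\<close> g0 by (metis rangeI)
        qed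
      next
        case (2 i j)
        from v show ?thesis
        proof (cases rule: attach_cycle_cases)
          case (1 i')
          have "g u \<notin> range c" using leaf(2)[OF g1(2)] 2 by simp
          then show ?thesis using eq 1(2) g0 by (metis rangeI)
        next
          case (2 i' j')
          note u = \<open>u = (i, j)\<close> \<open>1 \<le> j\<close> \<open>j \<le> ?p i\<close> \<open>i < r\<close>
          \<comment> \<open>A leaf determines its only neighbour and thereby \<open>i\<close>; then
            \<open>h i\<close> determines \<open>j\<close>.\<close>
          have "{c i} = {c i'}"
            using leaf(1)[OF g1(2)[OF u(2,3)]] leaf(1)[OF g1(2)[OF 2(2,3)]] eq u(1) 2(4) by simp
          then have i: "i = i'" using u(4) 2(1) by (simp add: c_eq_iff)
          have "h i j = h i j'" using eq u 2 g1(1) i by simp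
          then have "j = j'"
            using h[of i] u(2,3) 2(2,3) i by (auto simp: bij_betw_def dest: inj_onD)
          then show ?thesis using i u(1) 2(4) by simp
        qed
      qed
    qed
    moreover have "v \<in> g ` pverts ?A" for v
    proof (cases "v \<in> range c")
      case True
      then obtain i where "i < r" "v = c i" by (rule range_cE)
      then show ?thesis
        by (intro image_eqI[of _ _ "(i, 0)"]) (auto simp: g0 attach_pendants_def cycle_graph_def)
    next
      case False
      then obtain z where z: "neighbours G v = insert z (children v)" "Suc (depth z) = depth v"
        by (rule neighbours_off_cycle)
      with shallow[of v] have "z \<in> range c" by (simp flip: depth_eq_0_iff)
      then obtain i where i: "i < r" "z = c i" by (rule range_cE)
      have "(v, z) \<in> parcs G" using z(1) by (auto simp: neighbours_def)
      then have "v \<in> children (c i)"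
        using arcs_symmetric z(2) i(2) by (auto simp: children_def neighbours_def)
      then have "v \<in> h i ` {1..?p i}" using h[of i] by (simp add: bij_betw_def)
      then obtain j where "1 \<le> j" "j \<le> ?p i" "v = h i j" by auto
      then show ?thesis using i(1)
        by (intro image_eqI[of _ _ "(i, j)"]) (auto simp: g1 attach_pendants_def cycle_graph_def)
    qed
    ultimately show "bij_betw g (pverts ?A) (pverts G)"
      unfolding bij_betw_def verts_UNIV by auto
    fix u v assume u: "u \<in> pverts ?A" and v: "v \<in> pverts ?A"
    have leaf_adj: "(g (i, j), x) \<in> parcs G \<longleftrightarrow> x = c i" if "1 \<le> j" "j \<le> ?p i" for i j x
      using leaf(1)[OF g1(2)[OF that]] by (auto simp: neighbours_def)
    have leaf_adj': "(x, g (i, j)) \<in> parcs G \<longleftrightarrow> x = c i" if "1 \<le> j" "j \<le> ?p i" for i j x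
      using leaf_adj[OF that] arcs_symmetric by blast
    from u show "(g u, g v) \<in> parcs G \<longleftrightarrow> (u, v) \<in> parcs ?A"
    proof (cases rule: attach_cycle_cases)
      case (1 i)
      from v show ?thesis
      proof (cases rule: attach_cycle_cases)
        case (1 i')
        then show ?thesis using \<open>u = (i, 0)\<close> \<open>i < r\<close>
          by (simp add: g0 c_adj_iff attach_pendants_def)
      next
        case (2 i' j')
        then show ?thesis using \<open>u = (i, 0)\<close> \<open>i < r\<close>
          by (auto simp: g0 leaf_adj' c_eq_iff attach_pendants_def cycle_graph_def)
      qed
    next
      case (2 i j)
      from v show ?thesis
      proof (cases rule: attach_cycle_cases)
        case (1 i')
        then show ?thesis using 2
          by (auto simp: g0 leaf_adj c_eq_iff attach_pendants_def cycle_graph_def)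
      next
        case (2 i' j')
        have "g v \<noteq> c i" using leaf(2)[OF g1(2)[OF 2(2,3)]] 2(4) by auto
        then show ?thesis using 2 \<open>u = (i, j)\<close> \<open>1 \<le> j\<close> \<open>j \<le> ?p i\<close>
          by (auto simp: leaf_adj attach_pendants_def)
      qed
    qed
  qed
qed

end

section \<open>Consequences of the degree equation\<close>

locale two_main_graph = unicyclic_graph G c r
  for G :: "'a::finite pair_pre_digraph" and c r +
  fixes a b :: real
  assumes degree_eq: "real (nbr_deg_sum G v) = a * deg G v + b - (deg G v)\<^sup>2"
begin

text \<open>The neighbour degree sum of a leaf is the degree of its only neighbour, so neighbours of
  leaves all have the same degree.\<close>

lemma leaf_nbr_deg:
  assumes "deg G x = 1" "(x, w) \<in> parcs G"
  shows "deg G w = a + b - 1"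
proof -
  from assms(1) obtain w' where N: "neighbours G x = {w'}" unfolding deg_def by (auto simp: card_1_singleton_iff)
  moreover have "w \<in> neighbours G x" using assms(2) by (simp add: neighbours_def)
  ultimately have "nbr_deg_sum G x = deg G w" by (auto simp: nbr_deg_sum_def)
  then show ?thesis using degree_eq[of x] assms(1) by simp
qed

text \<open>A deepest vertex \<open>x\<close> has a parent \<open>w\<close> whose \<open>p\<close>
  children are all leaves, and \<open>w\<close> has a parent \<open>y\<close>. The equations at
  \<open>x\<close> and \<open>w\<close> fix \<open>a\<close> and \<open>b\<close> in terms of
  \<open>p\<close> and \<open>e\<close>; the equation at \<open>y\<close> is then
  contradictory.\<close>

lemma depth_le_1: "depth v \<le> 1"
proof (rule ccontr)
  assume deep: "\<not> depth v \<le> 1"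
  define M where "M = Max (range depth)"
  have M: "depth u \<le> M" for u unfolding M_def by (rule Max_ge) auto
  have "M \<in> range depth" unfolding M_def by (rule Max_in) auto
  then obtain x where x: "depth x = M" by auto
  have "M \<ge> 2" using deep M[of v] by simp
  have no_children: "children u = {}" if "depth u = M" for u
    using M that by (intro children_eq_empty) simp
  have off: "u \<notin> range c" if "depth u = Suc n" for u n
    using that by (simp flip: depth_eq_0_iff)
  have leaf: "deg G u = 1" if "depth u = M" for u
    using deg_off_cycle[OF off, of u "M - 1"] no_children[OF that] that \<open>M \<ge> 2\<close> by simp
  from x \<open>M \<ge> 2\<close> have "x \<notin> range c" using off[of x "M - 1"] by simp
  then obtain w where w: "neighbours G x = insert w (children x)" "Suc (depth w) = depth x"
    by (rule neighbours_off_cycle)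
  have xw: "(x, w) \<in> parcs G" using w(1) by (auto simp: neighbours_def)
  have dw: "Suc (depth w) = M" using w(2) x by simp
  have "w \<notin> range c" using dw \<open>M \<ge> 2\<close> off[of w "M - 2"] by simp
  then obtain y where y: "neighbours G w = insert y (children w)" "y \<notin> children w"
    "Suc (depth y) = depth w" by (rule neighbours_off_cycle)
  have wy: "(w, y) \<in> parcs G" using y(1) by (auto simp: neighbours_def)
  have "x \<in> children w" using xw w(2) arcs_symmetric by (auto simp: children_def neighbours_def)
  define p where "p = int (card (children w))"
  have "p \<ge> 1" using \<open>x \<in> children w\<close> unfolding p_def by (force simp: Suc_le_eq card_gt_0_iff)
  have deg_w: "int (deg G w) = p + 1" using deg_off_cycle[OF \<open>w \<notin> range c\<close>] by (simp add: p_def)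
  have ab: "a + b = p + 2"
    using leaf_nbr_deg[OF leaf[OF x] xw] deg_w by linarith
  define e where "e = int (deg G y) - 1"
  have "(\<Sum>u\<in>children w. deg G u) = (\<Sum>u\<in>children w. 1)"
    using dw leaf by (intro sum.cong) (auto simp: children_def)
  then have "int (nbr_deg_sum G w) = p + 1 + e"
    by (simp add: nbr_deg_sum_def y(1,2) p_def e_def)
  then have "real_of_int (p + 1 + e) = a * (p + 1) + b - (p + 1)\<^sup>2"
  proof -
    assume S: "int (nbr_deg_sum G w) = p + 1 + e"
    have "real (deg G w) = p + 1" using deg_w by linarith
    moreover have "real (nbr_deg_sum G w) = p + 1 + e" using S by linarith
    ultimately show ?thesis using degree_eq[of w] by simp
  qed
  then have pa: "p * a = p\<^sup>2 + 2 * p + e"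
    using ab by (simp add: algebra_simps power2_eq_square)
  \<comment> \<open>Multiplication by \<open>p\<close> eliminates the real constants and leaves an
    equation over the integers, open to divisibility arguments.\<close>
  have eqn: "p * int (nbr_deg_sum G u) =
      p * (p + 1) + (int (deg G u) - 1) * (p\<^sup>2 + p + e - p * int (deg G u))" for u
  proof -
    define d s where "d = int (deg G u)" and "s = int (nbr_deg_sum G u)"
    have s: "real_of_int s = a * d + b - d\<^sup>2" using degree_eq[of u] by (simp add: d_def s_def)
    have "p * real_of_int s = p * a * (d - 1) + p * (a + b) - p * d\<^sup>2"
      unfolding s by (simp add: algebra_simps)
    also have "\<dots> = real_of_int (p * (p + 1) + (d - 1) * (p\<^sup>2 + p + e - p * d))"
      unfolding ab pa by (simp add: algebra_simps power2_eq_square)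
    finally show ?thesis unfolding d_def s_def by (simp only: of_int_mult[symmetric] of_int_eq_iff)
  qed
  have wch: "w \<in> children y"
    using wy y(3) arcs_symmetric by (auto simp: children_def neighbours_def)
  have w_nbr: "w \<in> neighbours G y" using wch by (simp add: children_def)
  have ex_z: "\<exists>z\<in>neighbours G y - {w}. deg G z \<ge> 2"
  proof (cases "y \<in> range c")
    case True
    then obtain i where i: "i < r" "y = c i" by (rule range_cE)
    have "c (i + 1) \<in> neighbours G y - {w}"
      using neighbours_on_cycle(1)[OF i(1)] i(2) \<open>w \<notin> range c\<close> by auto
    then show ?thesis using deg_ge_2 by blast
  next
    case False
    then obtain z where z: "neighbours G y = insert z (children y)" "z \<notin> children y"
      "Suc (depth z) = depth y" by (rule neighbours_off_cycle)
    have "y \<in> children z" using z arcs_symmetric by (auto simp: children_def neighbours_def)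
    then have "deg G z \<ge> 2" using deg_ge_2 by blast
    then show ?thesis using z wch by auto
  qed
  \<comment> \<open>If \<open>e \<ge> p\<close>, the equation at \<open>y\<close> forces all neighbours of \<open>y\<close> other than \<open>w\<close> to be leaves.\<close>
  define X where "X = (\<Sum>u\<in>neighbours G y - {w}. int (deg G u) - 1)"
  have deg_pos: "u \<in> neighbours G y \<Longrightarrow> 1 \<le> deg G u" for u
  proof -
    assume "u \<in> neighbours G y"
    then have "y \<in> neighbours G u" using arcs_symmetric by (simp add: neighbours_def)
    then show "1 \<le> deg G u" by (force simp: deg_def Suc_le_eq card_gt_0_iff)
  qed
  have "X > 0"
  proof -
    obtain z where "z \<in> neighbours G y - {w}" "deg G z \<ge> 2" using ex_z by blast
    then show ?thesis unfolding X_def using deg_pos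
      by (intro sum_pos2[of _ z]) (auto simp: Suc_le_eq)
  qed
  have card_y: "int (card (neighbours G y - {w})) = e"
    using w_nbr deg_pos[OF w_nbr] card_gt_0_iff[of "neighbours G y"]
    by (auto simp: e_def deg_def card_Diff_singleton)
  have Sy: "int (nbr_deg_sum G y) = p + 1 + e + X"
  proof -
    have "nbr_deg_sum G y = deg G w + (\<Sum>u\<in>neighbours G y - {w}. deg G u)"
      unfolding nbr_deg_sum_def using w_nbr by (intro sum.remove) auto
    then show ?thesis using deg_w card_y by (simp add: X_def sum_subtractf)
  qed
  have deg_y: "int (deg G y) = e + 1" by (simp add: e_def)
  \<comment> \<open>The equation at \<open>y\<close>; positivity of the left side gives
    \<open>0 < e < p\<close>.\<close>
  have pX: "p * X = e * ((p - 1) * (p - e))"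
    using eqn[of y] unfolding Sy deg_y by (simp add: algebra_simps power2_eq_square)
  have "e \<ge> 0" using card_y by linarith
  have "e * ((p - 1) * (p - e)) > 0" using pX \<open>X > 0\<close> \<open>p \<ge> 1\<close> by (simp flip: pX)
  then have "e > 0" "e < p"
    using \<open>e \<ge> 0\<close> \<open>p \<ge> 1\<close> by (auto simp: zero_less_mult_iff)
  \<comment> \<open>If \<open>u\<close> were a leaf, \<open>y\<close> would have degree
    \<open>p + 1\<close>, against \<open>e < p\<close>. So \<open>u\<close> has children, which are
    leaves by maximality of \<open>M\<close>.\<close>
  have child_deg: "int (deg G u) = p + 1" if u: "u \<in> children y" for u
  proof -
    have du: "Suc (depth u) = M" using u y(3) dw by (simp add: children_def)
    then have "u \<notin> range c" using \<open>M \<ge> 2\<close> off[of u "M - 2"] by simp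
    show ?thesis
    proof (cases "children u = {}")
      case True
      then have "deg G u = 1" using deg_off_cycle[OF \<open>u \<notin> range c\<close>] by simp
      then have "deg G y = a + b - 1" using leaf_nbr_deg children_parent[OF u] by blast
      then have "e = p" using ab deg_y by linarith
      then show ?thesis using \<open>e < p\<close> by simp
    next
      case False
      then obtain q where q: "q \<in> children u" by blast
      then have "deg G q = 1" using leaf du by (simp add: children_def)
      then have "deg G u = a + b - 1" using leaf_nbr_deg children_parent[OF q] by blast
      then show ?thesis using ab by linarith
    qed
  qed
  have child_sum: "int (\<Sum>u\<in>children y. deg G u) = int (card (children y)) * (p + 1)"
    using child_deg by simp
  show False
  proof (cases "y \<in> range c")
    case True
    then obtain i where i: "y = c i" by auto
    \<comment> \<open>The predecessor of \<open>i\<close> modulo \<open>r\<close>, so that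
      \<open>y = c (Suc i')\<close>.\<close>
    define i' where "i' = i + r - 1"
    have y': "y = c (Suc i')" using r_ge_3 by (simp add: i i'_def c_eq_iff)
    have "int (card (children y)) = e - 1" using deg_y deg_on_cycle[of i] i by simp
    then have S: "int (nbr_deg_sum G y) = deg G (c i') + deg G (c (i' + 2)) + (e - 1) * (p + 1)"
      using child_sum unfolding y' nbr_deg_sum_cycle by simp
    \<comment> \<open>This is \<open>eqn\<close> read modulo \<open>p\<close>, after one factor
      \<open>p\<close> has been cancelled.\<close>
    have dvd: "p dvd (int (deg G u) - 1) * e" for u
    proof -
      define d where "d = int (deg G u)"
      have "(d - 1) * e = p * (int (nbr_deg_sum G u) - (p + 1) - (d - 1) * (p + 1 - d))"
        using eqn[of u] unfolding d_def[symmetric] by (simp add: algebra_simps power2_eq_square)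
      then show ?thesis unfolding d_def[symmetric] by simp
    qed
    show False
    proof (rule no_branch_on_cycle[OF \<open>e > 0\<close> \<open>e < p\<close> _ _ dvd dvd])
      show "p * (int (deg G (c i')) + int (deg G (c (i' + 2))) + (e - 1) * (p + 1)) =
          p * (p + 1) + e * (p\<^sup>2 + e - e * p)"
        using eqn[of y] unfolding S deg_y by (simp add: algebra_simps)
    qed (use deg_ge_2 in force)+
  next
    case False
    then obtain z where z: "neighbours G y = insert z (children y)" "z \<notin> children y"
      by (rule neighbours_off_cycle)
    have "int (card (children y)) = e" using deg_off_cycle[OF False] deg_y by simp
    then have S: "int (nbr_deg_sum G y) = deg G z + e * (p + 1)"
      using child_sum unfolding nbr_deg_sum_def z(1) using z(2) by simp
    show False
    proof (rule no_parent_off_cycle[OF \<open>e > 0\<close> \<open>e < p\<close>])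
      show "p * (int (deg G z) + e * (p + 1)) = p * (p + 1) + e * (p\<^sup>2 + e - e * p)"
        using eqn[of y] unfolding S deg_y by (simp add: algebra_simps)
      show "1 \<le> int (deg G z)" using deg_pos[of z] z(1) by simp
    qed
  qed
qed

lemma child_deg:
  assumes "w \<in> children (c i)"
  shows "deg G w = 1"
proof -
  have d: "depth w = 1" using assms by (simp add: children_def)
  then have "w \<notin> range c" by (simp flip: depth_eq_0_iff)
  moreover have "children w = {}" using depth_le_1 d by (intro children_eq_empty) simp
  ultimately show ?thesis by (simp add: deg_off_cycle)
qed

text \<open>Cycle degrees are 2 or \<open>\<Delta>\<close>, and the equation links three consecutive
  ones. If all are \<open>\<Delta>\<close>, the graph is some \<open>G1\<close>; otherwise a place
  where \<open>\<Delta>\<close> is followed by 2 forces \<open>\<Delta> = 3\<close>,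
  \<open>a = 5\<close> and the pattern 3, 2, 2.\<close>

lemma iso_G1_or_G2:
  assumes "children (c 0) \<noteq> {}"
  shows "(\<exists>k\<ge>1. digraph_iso (with_proj G) (with_proj (G1 r k))) \<or>
    (\<exists>t\<ge>1. digraph_iso (with_proj G) (with_proj (G2 t)))"
proof -
  define D where "D i = int (deg G (c i))" for i
  define \<Delta> where "\<Delta> = D 0"
  have D_children: "D i = int (card (children (c i))) + 2" for i by (simp add: D_def deg_on_cycle)
  have parent_deg: "D i = a + b - 1" if "children (c i) \<noteq> {}" for i
  proof -
    from that obtain x where x: "x \<in> children (c i)" by blast
    show ?thesis using leaf_nbr_deg[OF child_deg[OF x] children_parent[OF x]] by (simp add: D_def)
  qed
  have ab: "a + b = \<Delta> + 1" using parent_deg[OF assms] by (simp add: \<Delta>_def)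
  have D_cases: "D i = 2 \<or> D i = \<Delta>" for i
    using parent_deg[of i] ab D_children[of i] by (cases "children (c i) = {}") auto
  have "\<Delta> \<ge> 3"
    using assms by (simp add: \<Delta>_def D_children Suc_le_eq card_gt_0_iff)
  have periodic: "D (i + r) = D i" for i
  proof -
    have "c (i + r) = c i" by (simp add: c_eq_iff)
    then show ?thesis by (simp add: D_def)
  qed
  have eqn: "D (i + 1) - 2 + D i + D (i + 2) = \<Delta> + (D (i + 1) - 1) * (a - 1 - D (i + 1))" for i
  proof -
    have "int (\<Sum>w\<in>children (c (Suc i)). deg G w) = D (i + 1) - 2"
      using child_deg by (simp add: D_children)
    then have "D (i + 1) - 2 + D i + D (i + 2) = int (nbr_deg_sum G (c (Suc i)))"
      by (simp add: nbr_deg_sum_cycle D_def)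
    then have "real_of_int (D (i + 1) - 2 + D i + D (i + 2)) = a * D (i + 1) + b - (D (i + 1))\<^sup>2"
      using degree_eq[of "c (Suc i)"] by (simp add: D_def)
    also have "\<dots> = a * D (i + 1) + (\<Delta> + 1 - a) - (D (i + 1))\<^sup>2" using ab by simp
    finally show ?thesis by (simp add: algebra_simps power2_eq_square)
  qed
  have iso: "digraph_iso (with_proj G) (with_proj (attach_pendants (cycle_graph r) q))"
    if "\<And>i. i < r \<Longrightarrow> int (q i) = D i - 2" for q
  proof -
    have "attach_pendants (cycle_graph r) q = attach_pendants (cycle_graph r) (\<lambda>i. card (children (c i)))"
      using that by (intro attach_pendants_cong) (auto simp: D_children cycle_graph_def)
    then show ?thesis using iso_attach_pendants depth_le_1 by simp
  qed
  show ?thesis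
  proof (cases "\<forall>i. D i = \<Delta>")
    case True
    then have "digraph_iso (with_proj G) (with_proj (G1 r (nat (\<Delta> - 2))))"
      unfolding G1_def using \<open>\<Delta> \<ge> 3\<close> by (intro iso) simp
    moreover have "nat (\<Delta> - 2) \<ge> 1" using \<open>\<Delta> \<ge> 3\<close> by simp
    ultimately show ?thesis by blast
  next
    case False
    have "\<exists>i. D i = \<Delta> \<and> D (Suc i) \<noteq> \<Delta>"
    proof (rule ccontr)
      assume *: "\<nexists>i. D i = \<Delta> \<and> D (Suc i) \<noteq> \<Delta>"
      have "D i = \<Delta>" for i by (induction i) (use * in \<open>auto simp: \<Delta>_def\<close>)
      with False show False by blast
    qed
    then obtain i0 where i0: "D i0 = \<Delta>" "D (Suc i0) = 2" using D_cases by blast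
    \<comment> \<open>\<open>i0 - 1\<close> modulo \<open>r\<close>\<close>
    define i where "i = i0 + r - 1"
    have si: "i + 1 = i0 + r" "i + 2 = Suc i0 + r" using r_ge_3 by (auto simp: i_def)
    have i: "D (i + 1) = \<Delta>" "D (i + 2) = 2" unfolding si periodic by (fact i0)+
    \<comment> \<open>The equations at the adjacent positions \<open>i + 1\<close> and
      \<open>i + 2\<close>; the second shows that \<open>a\<close> is an integer.\<close>
    have A1: "D i = (\<Delta> - 1) * (a - 1 - \<Delta>)" using eqn[of i] unfolding i by simp
    have A2: "D (i + 3) = a - 3" using eqn[of "i + 1"] i by (simp add: numeral_eq_Suc)
    have "\<Delta> = 3 \<and> a = 5"
    proof -
      have a_eq: "a = D (i + 3) + 3" using A2 by simp
      have "real_of_int (D i) = real_of_int ((\<Delta> - 1) * (D (i + 3) + 2 - \<Delta>))"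
        using A1 unfolding a_eq by simp
      then have B1: "D i = (\<Delta> - 1) * (D (i + 3) + 2 - \<Delta>)" by (simp only: of_int_eq_iff)
      have "D (i + 3) \<noteq> \<Delta>"
      proof
        assume "D (i + 3) = \<Delta>"
        with B1 have "D i = 2 * \<Delta> - 2" by simp
        then show False using D_cases[of i] \<open>\<Delta> \<ge> 3\<close> by auto
      qed
      then have d3: "D (i + 3) = 2" using D_cases by blast
      \<comment> \<open>With \<open>D (i + 3) = 2\<close> the first equation reads
        \<open>D i = (\<Delta> - 1) * (4 - \<Delta>)\<close>, which must be positive.\<close>
      have "\<Delta> < 4"
      proof (rule ccontr)
        assume "\<not> \<Delta> < 4"
        then have "(\<Delta> - 1) * (4 - \<Delta>) \<le> 0" by (intro mult_nonneg_nonpos) auto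
        then show False using B1 d3 D_cases[of i] \<open>\<Delta> \<ge> 3\<close> by auto
      qed
      then show ?thesis using \<open>\<Delta> \<ge> 3\<close> a_eq d3 by auto
    qed
    then have \<Delta>: "\<Delta> = 3" and a: "a = 5" by auto
    have D23: "D i = 2 \<or> D i = 3" for i using D_cases \<Delta> by simp
    have at3: "D i = 2 \<and> D (i + 2) = 2" if "D (i + 1) = 3" for i
    proof -
      have "real_of_int (D i + D (i + 2)) = 4" using eqn[of i] that by (simp add: a \<Delta>)
      then have "D i + D (i + 2) = 4" by linarith
      then show ?thesis using D23[of i] D23[of "i + 2"] by auto
    qed
    have at2: "D i + D (i + 2) = 5" if "D (i + 1) = 2" for i
    proof -
      have "real_of_int (D i + D (i + 2)) = 5" using eqn[of i] that by (simp add: a \<Delta>)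
      then show ?thesis by linarith
    qed
    have pattern: "D (3 * k) = 3 \<and> D (3 * k + 1) = 2 \<and> D (3 * k + 2) = 2" for k
    proof (induction k)
      case 0
      have "D 0 = 3" using \<Delta> \<Delta>_def by simp
      moreover have "D 1 = 2"
      proof -
        \<comment> \<open>Position \<open>r - 1\<close> stands for -1, so that \<open>at3\<close>
          applies with centre 0.\<close>
        have "r - 1 + 1 = 0 + r" "r - 1 + 2 = 1 + r" using r_ge_3 by auto
        then show ?thesis using at3[of "r - 1"] periodic[of 0] periodic[of 1] \<open>D 0 = 3\<close> by metis
      qed
      moreover have "D 2 = 2" using at2[of 0] \<open>D 0 = 3\<close> \<open>D 1 = 2\<close> by (simp add: eval_nat_numeral)
      ultimately show ?case unfolding mult_0_right add_0 by blast
    next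
      case (Suc k)
      define j where "j = 3 * k"
      have s: "3 * Suc k = j + 3" "j + 1 + 1 = j + 2" "j + 1 + 2 = j + 3" "j + 2 + 1 = j + 3"
        "j + 2 + 2 = j + 4" "j + 3 + 1 = j + 4" "j + 3 + 2 = j + 5" by (auto simp: j_def)
      have "D j = 3" "D (j + 1) = 2" "D (j + 2) = 2" using Suc by (auto simp: j_def)
      moreover from this have "D (j + 3) = 3" using at2[of "j + 1"] unfolding s by simp
      moreover from this have "D (j + 4) = 2" using at3[of "j + 2"] unfolding s by simp
      moreover from this have "D (j + 5) = 2" using at2[of "j + 3"] \<open>D (j + 3) = 3\<close> unfolding s by simp
      ultimately show ?case unfolding s by simp
    qed
    have D_eq: "D i = (if 3 dvd i then 3 else 2)" for i
    proof -
      have "i = 3 * (i div 3) \<or> i = 3 * (i div 3) + 1 \<or> i = 3 * (i div 3) + 2" by linarith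
      moreover have "3 dvd i \<longleftrightarrow> i = 3 * (i div 3)" by presburger
      ultimately show ?thesis using pattern[of "i div 3"] by auto
    qed
    \<comment> \<open>The pattern of length 3 has to fit the period \<open>r\<close>.\<close>
    have "D r = 3" using periodic[of 0] D_eq[of 0] by simp
    then have "3 dvd r" using D_eq[of r] by (auto split: if_splits)
    then obtain t where t: "r = 3 * t" by auto
    have "digraph_iso (with_proj G) (with_proj (G2 t))"
      unfolding G2_conv t[symmetric] by (rule iso) (simp add: D_eq)
    moreover have "t \<ge> 1" using t r_ge_3 by simp
    ultimately show ?thesis by blast
  qed
qed

end

theorem theorem10:
  fixes G :: "'a::finite pair_pre_digraph"
  assumes "pair_graph G"
    and "pverts G = UNIV"
    and "unicyclic G"
    and "\<not> digraph_iso (with_proj G) (with_proj (cycle_graph (card (pverts G))))"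
  shows "card {\<mu>. main_signless_laplacian_eigenvalue G \<mu>} = 2 \<longleftrightarrow>
    (\<exists>r k. r \<ge> 3 \<and> k \<ge> 1 \<and> digraph_iso (with_proj G) (with_proj (G1 r k))) \<or>
    (\<exists>t. t \<ge> 1 \<and> digraph_iso (with_proj G) (with_proj (G2 t)))"
    (is "?two \<longleftrightarrow> ?iso")
proof
  assume two: ?two
  obtain c0 r where c0: "unicyclic_graph G c0 r"
    using assms(1-3) by (rule unicyclic_obtain_cycle)
  interpret C0: unicyclic_graph G c0 r by (rule c0)
  have "sym (parcs G)" using C0.arcs_symmetric by (auto intro: symI)
  with two obtain a b :: real
    where ab: "\<And>v. real (nbr_deg_sum G v) = a * deg G v + b - (deg G v)\<^sup>2"
    using card_main_signless_laplacian_eigenvalues by blast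
  \<comment> \<open>Stated for every numbering: the original one shows that the parent of
    \<open>x\<close> is on the cycle, and a shifted one then makes this parent
    \<open>c 0\<close>.\<close>
  have T: "two_main_graph G c r a b" if "unicyclic_graph G c r" for c
    using that ab by (simp add: two_main_graph_def two_main_graph_axioms_def)
  obtain x where x: "x \<notin> range c0" using C0.iso_cycle assms(4) by auto
  then obtain z where "neighbours G x = insert z (C0.children x)" "Suc (C0.depth z) = C0.depth x"
    by (rule C0.neighbours_off_cycle)
  then have z: "C0.depth z < C0.depth x" "(x, z) \<in> parcs G" by (auto simp: neighbours_def)
  have "C0.depth x \<le> 1" by (rule two_main_graph.depth_le_1[OF T[OF c0]])
  with z have "z \<in> range c0" by (simp flip: C0.depth_eq_0_iff)
  then obtain i where i: "z = c0 i" by auto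
  define c where "c j = c0 (j + i)" for j
  have c: "unicyclic_graph G c r" unfolding c_def by (rule C0.unicyclic_graph_shift)
  interpret two_main_graph G c r a b by (rule T[OF c])
  have "range c = range c0" unfolding c_def by (rule C0.range_c_shift)
  then have "x \<notin> range c" using x by simp
  then have "depth x = 1" using depth_le_1[of x] depth_eq_0_iff[of x] by simp
  moreover have "z = c 0" by (simp add: i c_def)
  ultimately have "x \<in> children (c 0)"
    using z(2) C0.arcs_symmetric by (auto simp: children_def neighbours_def)
  then show ?iso using iso_G1_or_G2 r_ge_3 by blast
next
  assume ?iso
  then show ?two using two_main_if_G1[OF assms(1,2)] two_main_if_G2[OF assms(1,2)] by blast
qed

end
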